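(* Over infinite full-binary trees the following hold: (1) For every integer $k>1$ there is a regular tree language that is $k$-ambiguous but not $(k-1)$-ambiguous. (2) There is a regular tree language that is finitely ambiguous but not boundedly ambiguous. (3) There is a regular tree language that is countably ambiguous but not finitely ambiguous. (4) There is a regular tree language (i.e. one accepted by some parity tree automaton, hence "uncountably ambiguous") that is not countably ambiguous.
   Context: The full-binary tree has node set $\{l,r\}^*$ with root $\epsilon$; the children of $v$ are $v\cdot l$ and $v\cdot r$. For a finite alphabet $\Sigma$, a $\Sigma$-labeled tree is a function $t:\{l,r\}^*\to\Sigma$; $T^\omega_\Sigma$ is the set of all such trees, and a tree language over $\Sigma$ is a subset of $T^\omega_\Sigma$. A parity tree automaton (PTA) is $\mathcal{A}=(Q,\Sigma,Q_I,\delta,\mathbb{C})$ with $Q$ finite, $Q_I\subseteq Q$ initial states, $\delta\subseteq Q\times\Sigma\times Q\times Q$, $\mathbb{C}:Q\to\mathbb{N}$. A computation of $\mathcal{A}$ on $t$ is $\phi:\{l,r\}^*\to Q$ with $\phi(\epsilon)\in Q_I$ and $(\phi(v),t(v),\phi(v\cdot l),\phi(v\cdot r))\in\delta$ for all $v$; it is accepting if along every branch (infinite sequence $v_0=\epsilon,v_1,\dots$ with each $v_{i+1}$ a child of $v_i$) the maximal color $\mathbb{C}(\phi(v_i))$ occurring infinitely often is even. $ACC(\mathcal{A},t)$ is the set of accepting computations, $L(\mathcal{A})=\{t: ACC(\mathcal{A},t)\neq\emptyset\}$; a tree language is regular if it is $L(\mathcal{A})$ for some PTA. $\mathcal{A}$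 is $k$-ambiguous if $|ACC(\mathcal{A},t)|\le k$ for all $t$; unambiguous if 1-ambiguous; boundedly ambiguous if $k$-ambiguous for some $k\in\mathbb{N}$; finitely (resp. countably) ambiguous if $ACC(\mathcal{A},t)$ is finite (resp. countable) for every $t$. A regular language is $k$-ambiguous (resp. boundedly, finitely, countably ambiguous) if it is accepted by some PTA with that property. *)

theory Defs
  imports Main "HOL-Library.Countable_Set"
begin

text \<open>Nodes of the full binary tree: words over {l,r}, encoded as bool lists
  (False = l, True = r); the root is the empty list; children of v are v@[False], v@[True].
  Alphabet symbols and automaton states are natural numbers drawn from finite sets.\<close>

type_synonym node = "bool list"
type_synonym tree = "node \<Rightarrow> nat"

definition trees :: "nat set \<Rightarrow> tree set" where
  "trees \<Sigma> = {t. \<forall>v. t v \<in> \<Sigma>}"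

record pta =
  states :: "nat set"
  alph :: "nat set"
  init :: "nat set"
  trans :: "(nat \<times> nat \<times> nat \<times> nat) set"
  color :: "nat \<Rightarrow> nat"

definition wf_pta :: "pta \<Rightarrow> bool" where
  "wf_pta A \<longleftrightarrow> finite (states A) \<and> finite (alph A) \<and> init A \<subseteq> states A \<and>
     trans A \<subseteq> states A \<times> alph A \<times> states A \<times> states A"

definition is_branch :: "(nat \<Rightarrow> node) \<Rightarrow> bool" where
  "is_branch p \<longleftrightarrow> p 0 = [] \<and> (\<forall>i. \<exists>b. p (Suc i) = p i @ [b])"

definition computation :: "pta \<Rightarrow> tree \<Rightarrow> (node \<Rightarrow> nat) \<Rightarrow> bool" where
  "computation A t \<phi> \<longleftrightarrow> \<phi> [] \<in> init A \<and>
     (\<forall>v. (\<phi> v, t v, \<phi> (v @ [False]), \<phi> (v @ [True])) \<in> trans A)"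

definition parity_ok :: "(nat \<Rightarrow> nat) \<Rightarrow> bool" where
  "parity_ok c \<longleftrightarrow> (\<exists>m. even m \<and> (\<exists>\<^sub>\<infinity>i. c i = m) \<and> (\<forall>m'. (\<exists>\<^sub>\<infinity>i. c i = m') \<longrightarrow> m' \<le> m))"

definition accepting :: "pta \<Rightarrow> tree \<Rightarrow> (node \<Rightarrow> nat) \<Rightarrow> bool" where
  "accepting A t \<phi> \<longleftrightarrow> computation A t \<phi> \<and>
     (\<forall>p. is_branch p \<longrightarrow> parity_ok (\<lambda>i. color A (\<phi> (p i))))"

definition ACC :: "pta \<Rightarrow> tree \<Rightarrow> (node \<Rightarrow> nat) set" where
  "ACC A t = {\<phi>. accepting A t \<phi>}"

definition lang :: "pta \<Rightarrow> tree set" where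
  "lang A = {t \<in> trees (alph A). ACC A t \<noteq> {}}"

definition regular_lang :: "nat set \<Rightarrow> tree set \<Rightarrow> bool" where
  "regular_lang \<Sigma> L \<longleftrightarrow> (\<exists>A. wf_pta A \<and> alph A = \<Sigma> \<and> lang A = L)"

definition k_ambiguous_lang :: "nat \<Rightarrow> nat set \<Rightarrow> tree set \<Rightarrow> bool" where
  "k_ambiguous_lang k \<Sigma> L \<longleftrightarrow> (\<exists>A. wf_pta A \<and> alph A = \<Sigma> \<and> lang A = L \<and>
      (\<forall>t \<in> trees \<Sigma>. finite (ACC A t) \<and> card (ACC A t) \<le> k))"

definition boundedly_ambiguous_lang :: "nat set \<Rightarrow> tree set \<Rightarrow> bool" where
  "boundedly_ambiguous_lang \<Sigma> L \<longleftrightarrow> (\<exists>k. k_ambiguous_lang k \<Sigma> L)"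

definition finitely_ambiguous_lang :: "nat set \<Rightarrow> tree set \<Rightarrow> bool" where
  "finitely_ambiguous_lang \<Sigma> L \<longleftrightarrow> (\<exists>A. wf_pta A \<and> alph A = \<Sigma> \<and> lang A = L \<and>
      (\<forall>t \<in> trees \<Sigma>. finite (ACC A t)))"

definition countably_ambiguous_lang :: "nat set \<Rightarrow> tree set \<Rightarrow> bool" where
  "countably_ambiguous_lang \<Sigma> L \<longleftrightarrow> (\<exists>A. wf_pta A \<and> alph A = \<Sigma> \<and> lang A = L \<and>
      (\<forall>t \<in> trees \<Sigma>. countable (ACC A t)))"

end

theory Submission
  imports Defs "HOL-Library.Sublist" "HOL-Library.FuncSet"
begin

text \<open>
  The type of a tree is the set of states from which a given automaton accepts it. The core is
  that for every automaton there is a tree s, not constantly 0, such that every state q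
  accepting s either accepts the constant tree 0, too, or accepts some tree of the same type as s
  with infinitely many runs. In a finitely ambiguous automaton the second case cannot occur in an
  accepting run, so there s can always be replaced by the zero tree.

  To find s, consider nonempty sets of types closed under filling the holes of a tree that is
  0 elsewhere, and a minimal such set Y. Since the finitely many one-hole contexts over Y act on Y
  and infinite iteration of a context yields a fixed point of its action, some context acts as a
  constant map. Nesting such contexts gives a tree s with infinitely many subtrees
  of the same type as s, any one of which may be replaced by any tree with type in Y without
  changing the type of s. Nesting a run on s into itself at all these subtrees gives a computation on
  the zero tree. If it is not accepting, then it has a rejecting branch, which must pass through
  infinitely many of the holes. Expanding s along this branch only, one obtains a tree which still
  has the type of s and has runs following the rejecting branch for arbitrarily long.
\<close>

section \<open>Branches and runs\<close>

text \<open>The languages demand zero or marked subtrees at incomparable positions (the root alone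
  for the countable case), so that exchanging the zero tree and a marked one changes membership.
  Where a zero subtree is demanded, exchanges yield many runs on one tree; where a marked one is
  demanded, the exchange is impossible and some tree has infinitely many runs.

  The obstacle in finding s: it must contain trees of its own type, so that runs on it can be
  nested, yet its type must ignore what is plugged in there, so that it survives expansion along an
  unknown rejecting branch. Pigeonholing alone gives only idempotent actions. Constancy also needs
  fixed points, which exclude nontrivial permutations, and the joining of two subtrees under a root
  labelled 0. Labels outside the holes are 0 because the nested computation has to read the zero
  tree. Minimality of Y makes every type in Y obtainable from every other one, so the types in holes
  can be adjusted at will.\<close>

definition pre :: "(nat \<Rightarrow> bool) \<Rightarrow> nat \<Rightarrow> node" where
  "pre \<beta> n = map \<beta> [0..<n]"

lemma pre_0 [simp]: "pre \<beta> 0 = []"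
  by (simp add: pre_def)

lemma pre_Suc: "pre \<beta> (Suc n) = pre \<beta> n @ [\<beta> n]"
  by (simp add: pre_def)

lemma length_pre [simp]: "length (pre \<beta> n) = n"
  by (simp add: pre_def)

lemma pre_add: "pre \<beta> (k + n) = pre \<beta> k @ pre (\<lambda>i. \<beta> (k + i)) n"
  by (induction n) (simp_all add: pre_Suc)

lemma pre_mono: "i \<le> j \<Longrightarrow> prefix (pre \<beta> i) (pre \<beta> j)"
  using pre_add[of \<beta> i "j - i"] by (simp add: prefix_def)

lemma is_branch_iff: "is_branch p \<longleftrightarrow> (\<exists>\<beta>. p = pre \<beta>)"
proof
  assume p: "is_branch p"
  define \<beta> where "\<beta> i = last (p (Suc i))" for i
  have "p i = pre \<beta> i" for i
  proof (induction i)
    case 0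
    then show ?case using p by (simp add: is_branch_def)
  next
    case (Suc i)
    obtain b where "p (Suc i) = p i @ [b]" using p by (auto simp: is_branch_def)
    then show ?case using Suc by (simp add: pre_Suc \<beta>_def)
  qed
  then show "\<exists>\<beta>. p = pre \<beta>" by blast
next
  assume "\<exists>\<beta>. p = pre \<beta>"
  then show "is_branch p" by (auto simp: is_branch_def pre_Suc)
qed

lemma frequently_shift: "(\<exists>\<^sub>\<infinity>i. P (k + i)) \<longleftrightarrow> (\<exists>\<^sub>\<infinity>i. P (i::nat))"
  using eventually_sequentially_seg[of "\<lambda>i. \<not> P i" k]
  by (simp add: frequently_def cofinite_eq_sequentially add.commute)

lemma parity_ok_shift: "parity_ok (\<lambda>i. c (k + i)) \<longleftrightarrow> parity_ok c"
  unfolding parity_ok_def using frequently_shift[of "\<lambda>i. c i = m" k for m] by simp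

lemma not_parity_ok_const: "odd m \<Longrightarrow> (\<And>i. c i = m) \<Longrightarrow> \<not> parity_ok c"
  by (auto simp: parity_ok_def)

lemma parity_ok_const: "even m \<Longrightarrow> (\<And>i. c i = m) \<Longrightarrow> parity_ok c"
  by (auto simp: parity_ok_def)

definition good_branch :: "pta \<Rightarrow> (node \<Rightarrow> nat) \<Rightarrow> (nat \<Rightarrow> bool) \<Rightarrow> bool" where
  "good_branch A \<phi> \<beta> \<longleftrightarrow> parity_ok (\<lambda>i. color A (\<phi> (pre \<beta> i)))"

definition step :: "pta \<Rightarrow> tree \<Rightarrow> (node \<Rightarrow> nat) \<Rightarrow> node \<Rightarrow> bool" where
  "step A t \<phi> v \<longleftrightarrow> (\<phi> v, t v, \<phi> (v @ [False]), \<phi> (v @ [True])) \<in> trans A"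

definition run :: "pta \<Rightarrow> nat \<Rightarrow> tree \<Rightarrow> (node \<Rightarrow> nat) \<Rightarrow> bool" where
  "run A q t \<phi> \<longleftrightarrow> \<phi> [] = q \<and> (\<forall>v. step A t \<phi> v) \<and> (\<forall>\<beta>. good_branch A \<phi> \<beta>)"

definition ty :: "pta \<Rightarrow> tree \<Rightarrow> nat set" where
  "ty A t = {q. \<exists>\<phi>. run A q t \<phi>}"

definition sub :: "(node \<Rightarrow> 'a) \<Rightarrow> node \<Rightarrow> node \<Rightarrow> 'a" where
  "sub t v = (\<lambda>u. t (v @ u))"

lemma sub_Nil [simp]: "sub t [] = t"
  by (simp add: sub_def)

lemma sub_sub [simp]: "sub (sub t v) w = sub t (v @ w)"
  by (simp add: sub_def)

lemma sub_apply: "sub t v u = t (v @ u)"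
  by (simp add: sub_def)

lemma accepting_iff_run: "accepting A t \<phi> \<longleftrightarrow> \<phi> [] \<in> init A \<and> run A (\<phi> []) t \<phi>"
  by (auto simp: accepting_def computation_def run_def step_def good_branch_def is_branch_iff)

lemma ACC_eq: "ACC A t = {\<phi>. \<exists>q\<in>init A. run A q t \<phi>}"
  by (auto simp: ACC_def accepting_iff_run run_def)

lemma lang_eq: "lang A = {t \<in> trees (alph A). \<exists>q\<in>init A. q \<in> ty A t}"
  by (auto simp: lang_def ACC_eq ty_def)

text \<open>Acceptance along a branch is a tail property. This is what allows runs to be cut and
  glued at arbitrary nodes.\<close>

lemma good_branch_append:
  "good_branch A \<phi> \<beta> \<longleftrightarrow> good_branch A (sub \<phi> (pre \<beta> k)) (\<lambda>i. \<beta> (k + i))"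
  unfolding good_branch_def sub_def
  using parity_ok_shift[of "\<lambda>i. color A (\<phi> (pre \<beta> i))" k] by (simp add: pre_add)

lemma ex_branch_append: "\<exists>\<gamma>. pre \<gamma> (length v) = v \<and> (\<lambda>i. \<gamma> (length v + i)) = \<beta>"
proof (intro exI conjI)
  let ?\<gamma> = "\<lambda>i. if i < length v then v ! i else \<beta> (i - length v)"
  show "pre ?\<gamma> (length v) = v" by (rule nth_equalityI) (auto simp: pre_def)
  show "(\<lambda>i. ?\<gamma> (length v + i)) = \<beta>" by simp
qed

lemma step_sub: "step A (sub t v) (sub \<phi> v) w \<longleftrightarrow> step A t \<phi> (v @ w)"
  by (simp add: step_def sub_def)

lemma run_sub:
  assumes "run A q t \<phi>"
  shows "run A (\<phi> v) (sub t v) (sub \<phi> v)"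
proof -
  have "good_branch A (sub \<phi> v) \<beta>" for \<beta>
  proof -
    obtain \<gamma> where "pre \<gamma> (length v) = v" "(\<lambda>i. \<gamma> (length v + i)) = \<beta>"
      using ex_branch_append by blast
    then show ?thesis
      using good_branch_append[of A \<phi> \<gamma> "length v"] assms by (simp add: run_def)
  qed
  then show ?thesis using assms by (auto simp: run_def step_sub sub_apply)
qed

lemma ty_sub: "run A q t \<phi> \<Longrightarrow> \<phi> v \<in> ty A (sub t v)"
  unfolding ty_def using run_sub by blast

lemma ty_subset_states: "wf_pta A \<Longrightarrow> ty A t \<subseteq> states A"
proof
  fix q assume A: "wf_pta A" and "q \<in> ty A t"
  then obtain \<phi> where "\<phi> [] = q" "step A t \<phi> []" by (auto simp: ty_def run_def)
  then show "q \<in> states A" using A by (auto simp: step_def wf_pta_def)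
qed

section \<open>Grafting\<close>

definition antichain :: "node set \<Rightarrow> bool" where
  "antichain H \<longleftrightarrow> (\<forall>h\<in>H. \<forall>h'\<in>H. prefix h h' \<longrightarrow> h = h')"

definition below :: "node set \<Rightarrow> node \<Rightarrow> bool" where
  "below H v \<longleftrightarrow> (\<exists>h\<in>H. prefix h v)"

text \<open>All holes are filled at once, since the antichains in question are often infinite. On an
  antichain the hole above \<open>v\<close> is unique, so the description \<open>THE h\<close> is
  proper.\<close>

definition graft :: "node set \<Rightarrow> (node \<Rightarrow> 'a) \<Rightarrow> (node \<Rightarrow> node \<Rightarrow> 'a) \<Rightarrow> node \<Rightarrow> 'a" where
  "graft H t f v =
     (if below H v
      then let h = (THE h. h \<in> H \<and> prefix h v) in f h (drop (length h) v)
      else t v)"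

abbreviation plug :: "(node \<Rightarrow> 'a) \<Rightarrow> node \<Rightarrow> (node \<Rightarrow> 'a) \<Rightarrow> node \<Rightarrow> 'a" where
  "plug t h u \<equiv> graft {h} t (\<lambda>_. u)"

lemma antichainD: "antichain H \<Longrightarrow> h \<in> H \<Longrightarrow> h' \<in> H \<Longrightarrow> prefix h h' \<Longrightarrow> h = h'"
  by (simp add: antichain_def)

lemma antichain_singleton [simp]: "antichain {h}"
  by (simp add: antichain_def)

lemma antichain_below_unique:
  "antichain H \<Longrightarrow> h \<in> H \<Longrightarrow> h' \<in> H \<Longrightarrow> prefix h v \<Longrightarrow> prefix h' v \<Longrightarrow> h = h'"
  using prefix_same_cases[of h v h'] by (auto simp: antichain_def)

lemma below_singleton [simp]: "below {h} v \<longleftrightarrow> prefix h v"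
  by (simp add: below_def)

lemma belowI: "h \<in> H \<Longrightarrow> below H (h @ v)"
  unfolding below_def by (blast intro: prefixI)

lemma belowE: "below H v \<Longrightarrow> (\<And>h u. h \<in> H \<Longrightarrow> v = h @ u \<Longrightarrow> thesis) \<Longrightarrow> thesis"
  by (auto simp: below_def prefix_def)

lemma below_snoc: "below H (v @ [b]) \<longleftrightarrow> below H v \<or> v @ [b] \<in> H"
  by (auto simp: below_def)

lemma graft_below: "antichain H \<Longrightarrow> h \<in> H \<Longrightarrow> graft H t f (h @ u) = f h u"
proof -
  assume "antichain H" "h \<in> H"
  then have "(THE h'. h' \<in> H \<and> prefix h' (h @ u)) = h"
    by (intro the_equality) (auto intro: antichain_below_unique)
  then show ?thesis using \<open>h \<in> H\<close> by (simp add: graft_def belowI)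
qed

lemma graft_at: "antichain H \<Longrightarrow> h \<in> H \<Longrightarrow> graft H t f h = f h []"
  using graft_below[of H h t f "[]"] by simp

lemma graft_off: "\<not> below H v \<Longrightarrow> graft H t f v = t v"
  by (simp add: graft_def)

lemma sub_graft: "antichain H \<Longrightarrow> h \<in> H \<Longrightarrow> sub (graft H t f) h = f h"
  by (rule ext) (simp add: sub_apply graft_below)

lemma sub_plug [simp]: "sub (plug t h u) h = u"
  by (simp add: sub_graft)

lemma sub_plug_incomparable:
  assumes "\<not> prefix h k" "\<not> prefix k h"
  shows "sub (plug t h u) k = sub t k"
proof
  fix v
  have "\<not> prefix h (k @ v)" using assms prefix_same_cases[of h "k @ v" k] by auto
  then show "sub (plug t h u) k v = sub t k v" by (simp add: sub_apply graft_off)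
qed

lemma sub_plug_antichain:
  "antichain H \<Longrightarrow> h \<in> H \<Longrightarrow> k \<in> H \<Longrightarrow> k \<noteq> h \<Longrightarrow> sub (plug t h u) k = sub t k"
  by (intro sub_plug_incomparable) (auto simp: antichain_def)

lemma plug_append: "plug t (h @ k) u = plug t h (plug (sub t h) k u)"
proof
  fix v
  show "plug t (h @ k) u v = plug t h (plug (sub t h) k u) v"
  proof (cases "prefix h v")
    case True
    then obtain w where v: "v = h @ w" by (auto simp: prefix_def)
    show ?thesis
    proof (cases "prefix k w")
      case True
      then obtain x where "w = k @ x" by (auto simp: prefix_def)
      then show ?thesis
        using v graft_below[of "{h @ k}" "h @ k" t "\<lambda>_. u" x] by (simp add: graft_below)
    next
      case False
      then show ?thesis using v by (simp add: graft_below graft_off sub_apply)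
    qed
  next
    case False
    then have "\<not> prefix (h @ k) v" by (auto simp: prefix_def)
    with False show ?thesis by (simp add: graft_off)
  qed
qed

lemma below_pre:
  assumes "below H (pre \<beta> n)"
  shows "\<exists>h\<in>H. pre \<beta> (length h) = h"
proof -
  obtain h where h: "h \<in> H" "prefix h (pre \<beta> n)" using assms by (auto simp: below_def)
  then have "length h \<le> n" using prefix_length_le[OF h(2)] by simp
  then have "prefix (pre \<beta> (length h)) (pre \<beta> n)" by (rule pre_mono)
  then have "pre \<beta> (length h) = h" using h(2) by (auto simp: prefix_def)
  with h show ?thesis by blast
qed

text \<open>Only the part of \<open>\<phi>\<close> above the holes has to be correct: its value at a
  hole prescribes the state in which \<open>\<psi> h\<close> starts, and a branch that enters a hole
  inherits acceptance from its tail.\<close>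

lemma run_graft:
  assumes H: "antichain H"
    and root: "\<phi> [] = q"
    and step: "\<And>v. \<not> below H v \<Longrightarrow> step A t \<phi> v"
    and good: "\<And>\<beta>. (\<And>n. \<not> below H (pre \<beta> n)) \<Longrightarrow> good_branch A \<phi> \<beta>"
    and runs: "\<And>h. h \<in> H \<Longrightarrow> run A (\<phi> h) (sub t h) (\<psi> h)"
  shows "run A q t (graft H \<phi> \<psi>)"
proof -
  let ?\<phi> = "graft H \<phi> \<psi>"
  have at: "?\<phi> h = \<phi> h" if "h \<in> H" for h
    using graft_at[OF H that, of \<phi> \<psi>] runs[OF that] by (simp add: run_def)
  have eq: "?\<phi> v = \<phi> v" if "\<not> below H v \<or> v \<in> H" for v
    using that at graft_off by metis
  have "step A t ?\<phi> v" for v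
  proof (cases "below H v")
    case True
    then obtain h u where h: "h \<in> H" "v = h @ u" by (rule belowE)
    have "step A (sub t h) (\<psi> h) u" using runs[OF h(1)] by (simp add: run_def)
    then show ?thesis
      using step_sub[of A t h ?\<phi> u] sub_graft[OF H h(1), of \<phi> \<psi>] h(2) by simp
  next
    case False
    then have "?\<phi> (v @ [b]) = \<phi> (v @ [b])" for b by (intro eq) (auto simp: below_snoc)
    then show ?thesis using step[OF False] eq False by (simp add: step_def)
  qed
  moreover have "good_branch A ?\<phi> \<beta>" for \<beta>
  proof (cases "\<exists>n. below H (pre \<beta> n)")
    case True
    then obtain h where h: "h \<in> H" "pre \<beta> (length h) = h" using below_pre by blast
    then show ?thesis
      using good_branch_append[of A ?\<phi> \<beta> "length h"] sub_graft[OF H h(1), of \<phi> \<psi>] runs[OF h(1)]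
      by (simp add: run_def)
  next
    case False
    then have "?\<phi> (pre \<beta> n) = \<phi> (pre \<beta> n)" for n by (simp add: eq)
    then show ?thesis using good[of \<beta>] False by (simp add: good_branch_def)
  qed
  moreover have "?\<phi> [] = q"
  proof (cases "below H []")
    case True
    then have "[] \<in> H" by (auto simp: below_def)
    then show ?thesis using at root by simp
  next
    case False
    then show ?thesis using graft_off root by metis
  qed
  ultimately show ?thesis by (simp add: run_def)
qed

lemma run_graft_run:
  assumes "antichain H" "run A q t \<phi>"
    and "\<And>v. \<not> below H v \<Longrightarrow> t' v = t v"
    and "\<And>h. h \<in> H \<Longrightarrow> run A (\<phi> h) (sub t' h) (\<psi> h)"
  shows "run A q t' (graft H \<phi> \<psi>)"
  using assms by (intro run_graft) (auto simp: run_def step_def)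

lemma run_plug:
  assumes "run A q t \<phi>" "run A (\<phi> h) u \<psi>"
  shows "run A q (plug t h u) (plug \<phi> h \<psi>)"
  using assms by (intro run_graft_run[of "{h}"]) (auto simp: graft_off)

text \<open>A run on \<open>t\<close> reaches each hole in a state that accepts the subtree there,
  hence also the new one. Choosing a run for every hole exchanges all subtrees simultaneously, even
  infinitely many.\<close>

lemma ty_mono:
  assumes "antichain H" "\<And>v. \<not> below H v \<Longrightarrow> t' v = t v"
    and "\<And>h. h \<in> H \<Longrightarrow> ty A (sub t h) \<subseteq> ty A (sub t' h)"
  shows "ty A t \<subseteq> ty A t'"
proof
  fix q assume "q \<in> ty A t"
  then obtain \<phi> where \<phi>: "run A q t \<phi>" by (auto simp: ty_def)
  have "\<forall>h\<in>H. \<exists>\<psi>. run A (\<phi> h) (sub t' h) \<psi>"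
    using ty_sub[OF \<phi>] assms(3) by (fastforce simp: ty_def)
  then obtain \<psi> where "\<forall>h\<in>H. run A (\<phi> h) (sub t' h) (\<psi> h)" by metis
  then have "run A q t' (graft H \<phi> \<psi>)"
    using run_graft_run[OF assms(1) \<phi> assms(2)] by blast
  then show "q \<in> ty A t'" by (auto simp: ty_def)
qed

lemma ty_cong:
  assumes "antichain H" "\<And>v. \<not> below H v \<Longrightarrow> t v = t' v"
    and "\<And>h. h \<in> H \<Longrightarrow> ty A (sub t h) = ty A (sub t' h)"
  shows "ty A t = ty A t'"
proof (rule equalityI)
  show "ty A t \<subseteq> ty A t'"
    by (rule ty_mono[OF assms(1) sym[OF assms(2)] equalityD1[OF assms(3)]])
  show "ty A t' \<subseteq> ty A t"
    by (rule ty_mono[OF assms(1) assms(2) equalityD2[OF assms(3)]])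
qed

lemma ty_plug_same: "ty A u = ty A (sub t h) \<Longrightarrow> ty A (plug t h u) = ty A t"
  by (rule ty_cong[of "{h}"]) (auto simp: graft_off)

section \<open>Closed sets of types\<close>

abbreviation zero_tree :: tree where
  "zero_tree \<equiv> \<lambda>_. 0"

definition marked :: "tree set" where
  "marked = trees {0, 1} - {zero_tree}"

definition zero_off :: "node set \<Rightarrow> tree \<Rightarrow> bool" where
  "zero_off H t \<longleftrightarrow> (\<forall>v. \<not> below H v \<longrightarrow> t v = 0)"

definition typed :: "pta \<Rightarrow> nat set set \<Rightarrow> tree set" where
  "typed A Y = {t \<in> marked. ty A t \<in> Y}"

text \<open>The antichain may be infinite and need not meet every branch; infinite nesting leaves
  holes of just this kind. The empty antichain is excluded because it would put the type of the zero
  tree into \<open>Y\<close>.\<close>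

definition closed_types :: "pta \<Rightarrow> nat set set \<Rightarrow> bool" where
  "closed_types A Y \<longleftrightarrow>
     (\<forall>H t. antichain H \<and> H \<noteq> {} \<and> zero_off H t \<and> (\<forall>h\<in>H. sub t h \<in> typed A Y) \<longrightarrow> ty A t \<in> Y)"

lemma marked_region:
  assumes "antichain H" "H \<noteq> {}" "zero_off H t" "\<And>h. h \<in> H \<Longrightarrow> sub t h \<in> marked"
  shows "t \<in> marked"
proof -
  have "t v \<in> {0, 1}" for v
  proof (cases "below H v")
    case True
    then obtain h u where h: "h \<in> H" "v = h @ u" by (rule belowE)
    have "sub t h u \<in> {0, 1}" using assms(4)[OF h(1)] unfolding marked_def trees_def by blast
    then show ?thesis using h by (simp add: sub_apply)
  next
    case False
    then show ?thesis using assms(3) by (simp add: zero_off_def)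
  qed
  moreover have "t \<noteq> zero_tree"
  proof
    assume "t = zero_tree"
    moreover obtain h where "h \<in> H" using assms(2) by blast
    ultimately have "zero_tree \<in> marked" using assms(4)[of h] by (simp add: sub_def)
    then show False by (simp add: marked_def)
  qed
  ultimately show ?thesis by (simp add: marked_def trees_def)
qed

lemma typed_marked: "t \<in> typed A Y \<Longrightarrow> t \<in> marked"
  by (simp add: typed_def)

lemma typed_region:
  assumes "closed_types A Y" "antichain H" "H \<noteq> {}" "zero_off H t"
    and "\<And>h. h \<in> H \<Longrightarrow> sub t h \<in> typed A Y"
  shows "t \<in> typed A Y"
proof -
  have "t \<in> marked" using marked_region[OF assms(2-4)] typed_marked[OF assms(5)] by blast
  moreover have "ty A t \<in> Y"
    using assms(1)[unfolded closed_types_def, rule_format, of H t] assms(2-5) by simp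
  ultimately show ?thesis by (simp add: typed_def)
qed

lemma zero_off_plug:
  assumes "zero_off H t" "h \<in> H"
  shows "zero_off H (plug t h u)"
  unfolding zero_off_def
proof (intro allI impI)
  fix v assume v: "\<not> below H v"
  then have "\<not> prefix h v" using assms(2) by (auto simp: below_def)
  then show "plug t h u v = 0" using assms(1) v by (simp add: graft_off zero_off_def)
qed

lemma zero_off_graft: "zero_off H (graft H zero_tree f)"
  by (simp add: zero_off_def graft_off)

section \<open>Minimal closed sets of types and connections between their elements\<close>

definition minimal_types :: "pta \<Rightarrow> nat set set \<Rightarrow> bool" where
  "minimal_types A Y \<longleftrightarrow> Y \<subseteq> ty A ` marked \<and> finite Y \<and> Y \<noteq> {} \<and> closed_types A Y \<and>
     (\<forall>Y'\<subseteq>Y. Y' \<noteq> {} \<longrightarrow> closed_types A Y' \<longrightarrow> Y' = Y)"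

lemma one_in_marked: "(\<lambda>_. 1) \<in> marked"
  by (auto simp: marked_def trees_def fun_eq_iff)

lemma ex_minimal_types:
  assumes "wf_pta A"
  shows "\<exists>Y. minimal_types A Y"
proof -
  let ?C = "{Y. Y \<subseteq> ty A ` marked \<and> Y \<noteq> {} \<and> closed_types A Y}"
  have "ty A ` marked \<subseteq> Pow (states A)" using ty_subset_states[OF assms] by blast
  then have fin: "finite (ty A ` marked)"
    using assms by (auto simp: wf_pta_def intro: finite_subset)
  have "closed_types A (ty A ` marked)"
    unfolding closed_types_def
  proof (intro allI impI, elim conjE)
    fix H t assume "antichain H" "H \<noteq> {}" "zero_off H t" "\<forall>h\<in>H. sub t h \<in> typed A (ty A ` marked)"
    then have "t \<in> marked" using marked_region[of H t] typed_marked by blast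
    then show "ty A t \<in> ty A ` marked" by blast
  qed
  then have "ty A ` marked \<in> ?C" using one_in_marked by blast
  then have "?C \<noteq> {}" by blast
  moreover have "finite ?C" using fin by (intro finite_subset[of ?C "Pow (ty A ` marked)"]) auto
  ultimately have "\<exists>Y\<in>?C. \<forall>Y'\<in>?C. Y' \<subseteq> Y \<longrightarrow> Y = Y'"
    by (intro finite_has_minimal)
  then obtain Y where Y: "Y \<in> ?C" "\<forall>Y'\<in>?C. Y' \<subseteq> Y \<longrightarrow> Y = Y'" ..
  then have "minimal_types A Y"
    unfolding minimal_types_def using finite_subset[OF _ fin, of Y] by blast
  then show ?thesis by blast
qed

lemma below_compose_off:
  "\<not> below H v \<Longrightarrow> \<not> below {h @ k |h k. h \<in> H \<and> k \<in> K h} v"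
  by (auto simp: below_def prefix_def)

lemma below_compose_at:
  assumes "antichain H" "h \<in> H"
  shows "below {h @ k |h k. h \<in> H \<and> k \<in> K h} (h @ v) \<longleftrightarrow> below (K h) v"
proof
  assume "below {h @ k |h k. h \<in> H \<and> k \<in> K h} (h @ v)"
  then obtain h' k where h': "h' \<in> H" "k \<in> K h'" "prefix (h' @ k) (h @ v)"
    by (auto simp: below_def)
  then have "h' = h"
    using antichain_below_unique[OF assms(1) h'(1) assms(2), of "h @ v"] append_prefixD[OF h'(3)]
    by simp
  then show "below (K h) v" using h' by (auto simp: below_def)
next
  assume "below (K h) v"
  then show "below {h @ k |h k. h \<in> H \<and> k \<in> K h} (h @ v)"
    using assms(2) by (fastforce simp: below_def)
qed

lemma antichain_compose:
  assumes "antichain H" "\<And>h. h \<in> H \<Longrightarrow> antichain (K h)"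
  shows "antichain {h @ k |h k. h \<in> H \<and> k \<in> K h}"
  unfolding antichain_def
proof (intro ballI impI)
  fix x y assume "x \<in> {h @ k |h k. h \<in> H \<and> k \<in> K h}" "y \<in> {h @ k |h k. h \<in> H \<and> k \<in> K h}" "prefix x y"
  then obtain h k h' k' where *: "x = h @ k" "h \<in> H" "k \<in> K h" "y = h' @ k'" "h' \<in> H" "k' \<in> K h'"
    "prefix (h @ k) (h' @ k')" by blast
  then have "h = h'"
    using antichain_below_unique[OF assms(1) *(2) *(5), of "h' @ k'"] append_prefixD[OF *(7)] by simp
  then show "x = y" using * assms(2)[OF *(2)] by (auto simp: antichain_def)
qed

lemma zero_off_compose:
  assumes "antichain H" "zero_off {h @ k |h k. h \<in> H \<and> k \<in> K h} t" "h \<in> H"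
  shows "zero_off (K h) (sub t h)"
  using assms below_compose_at[OF assms(1,3), of K] by (simp add: zero_off_def sub_apply)

text \<open>The types obtainable from \<open>y\<close> in this way form a nonempty closed subset of
  \<open>Y\<close>: constructions compose by putting, into each hole, the holes of the construction
  for its type. By minimality the subset is \<open>Y\<close>.\<close>

lemma connect_types:
  assumes Y: "minimal_types A Y" and "y \<in> Y" "y' \<in> Y"
  shows "\<exists>K. antichain K \<and> K \<noteq> {} \<and>
    (\<forall>t. zero_off K t \<and> (\<forall>k\<in>K. sub t k \<in> marked \<and> ty A (sub t k) = y) \<longrightarrow> ty A t = y')"
proof -
  let ?P = "\<lambda>K y'. antichain K \<and> K \<noteq> {} \<and>
    (\<forall>t. zero_off K t \<and> (\<forall>k\<in>K. sub t k \<in> marked \<and> ty A (sub t k) = y) \<longrightarrow> ty A t = y')"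
  let ?Y = "{y' \<in> Y. \<exists>K. ?P K y'}"
  \<comment> \<open>A single hole at the root yields \<open>y\<close> itself, so the subset is
    nonempty.\<close>
  have "antichain {[]}" by simp
  moreover have "zero_off {[]} t" for t by (simp add: zero_off_def)
  ultimately have "?P {[]} y" by simp
  then have "y \<in> ?Y" using assms(2) by blast
  moreover have "closed_types A ?Y"
    unfolding closed_types_def
  proof (intro allI impI, elim conjE)
    fix H t
    assume H: "antichain H" "H \<noteq> {}" "zero_off H t" "\<forall>h\<in>H. sub t h \<in> typed A ?Y"
    then have sub: "\<forall>h\<in>H. sub t h \<in> typed A Y" by (auto simp: typed_def)
    have "\<forall>h\<in>H. \<exists>K. ?P K (ty A (sub t h))" using H(4) by (simp add: typed_def)
    then obtain K where K: "\<And>h. h \<in> H \<Longrightarrow> ?P (K h) (ty A (sub t h))"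
      using bchoice[of H "\<lambda>h K. ?P K (ty A (sub t h))"] by blast
    let ?K = "{h @ k |h k. h \<in> H \<and> k \<in> K h}"
    have "ty A t' = ty A t"
      if t': "zero_off ?K t'" "\<forall>k\<in>?K. sub t' k \<in> marked \<and> ty A (sub t' k) = y" for t'
    proof (rule ty_cong[OF H(1)])
      fix v assume "\<not> below H v"
      then show "t' v = t v"
        using H(3) t'(1) below_compose_off[of H v K] by (simp add: zero_off_def)
    next
      fix h assume h: "h \<in> H"
      have "\<forall>k\<in>K h. sub (sub t' h) k \<in> marked \<and> ty A (sub (sub t' h) k) = y"
        using t'(2) h by auto
      then show "ty A (sub t' h) = ty A (sub t h)"
        using K[OF h] zero_off_compose[OF H(1) t'(1) h] by blast
    qed
    moreover have "antichain ?K" using antichain_compose[OF H(1)] K by blast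
    moreover have "?K \<noteq> {}"
    proof -
      obtain h where h: "h \<in> H" using H(2) by blast
      then have "K h \<noteq> {}" using K by blast
      with h show ?thesis by blast
    qed
    ultimately have "?P ?K (ty A t)" by blast
    moreover have "ty A t \<in> Y"
      using typed_region[of A Y H t] Y H(1-3) sub by (simp add: minimal_types_def typed_def)
    ultimately show "ty A t \<in> ?Y" by blast
  qed
  ultimately have "?Y = Y"
    using Y[unfolded minimal_types_def, THEN conjunct2, THEN conjunct2, THEN conjunct2, THEN conjunct2,
        rule_format, of ?Y] by blast
  then show ?thesis using assms(3) by blast
qed

section \<open>Contexts\<close>

text \<open>A one-hole context: \<open>h\<close> is open, the other holes are filled. The condition
  \<open>H \<noteq> {h}\<close> keeps a marked subtree outside the open hole, so that even the
  infinite iteration of a context is a marked tree; it also forces \<open>h\<close> to be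
  nonempty.\<close>

definition ctxt :: "pta \<Rightarrow> nat set set \<Rightarrow> tree \<Rightarrow> node \<Rightarrow> node set \<Rightarrow> bool" where
  "ctxt A Y t h H \<longleftrightarrow> antichain H \<and> h \<in> H \<and> H \<noteq> {h} \<and> zero_off H t \<and>
     (\<forall>k\<in>H - {h}. sub t k \<in> typed A Y)"

lemma ctxt_not_Nil: "ctxt A Y t h H \<Longrightarrow> h \<noteq> []"
proof
  assume "ctxt A Y t h H" "h = []"
  then have "antichain H" "[] \<in> H" "H \<noteq> {[]}" by (simp_all add: ctxt_def)
  then obtain k where "k \<in> H" "k \<noteq> []" by auto
  then show False using antichainD[OF \<open>antichain H\<close> \<open>[] \<in> H\<close>, of k] by simp
qed

lemma sub_plug_ctxt: "ctxt A Y t h H \<Longrightarrow> k \<in> H - {h} \<Longrightarrow> sub (plug t h u) k = sub t k"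
  by (auto simp: ctxt_def intro: sub_plug_antichain)

lemma typed_plug:
  assumes "closed_types A Y" "ctxt A Y t h H" "u \<in> typed A Y"
  shows "plug t h u \<in> typed A Y"
proof (rule typed_region[OF assms(1), of H])
  fix k assume k: "k \<in> H"
  show "sub (plug t h u) k \<in> typed A Y"
  proof (cases "k = h")
    case False
    then have "sub (plug t h u) k = sub t k" using k sub_plug_ctxt[OF assms(2)] by blast
    then show ?thesis using False k assms(2) by (simp add: ctxt_def)
  qed (use assms(3) in simp)
qed (use assms(2) in \<open>auto simp: ctxt_def intro: zero_off_plug\<close>)

lemma ctxt_compose:
  assumes C: "ctxt A Y t h H" and C': "ctxt A Y t' h' H'"
  shows "ctxt A Y (plug t h t') (h @ h') ((H - {h}) \<union> (@) h ` H')"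
proof -
  \<comment> \<open>Composition replaces the hole \<open>h\<close> by \<open>H'\<close> and every
    other hole by itself, so the general lemmas on composed antichains apply.\<close>
  let ?K = "\<lambda>k. if k = h then H' else {[]}"
  have eq: "(H - {h}) \<union> (@) h ` H' = {k @ l |k l. k \<in> H \<and> l \<in> ?K k}" (is "_ = ?H")
  proof (rule set_eqI)
    fix v
    show "v \<in> (H - {h}) \<union> (@) h ` H' \<longleftrightarrow> v \<in> ?H"
      using C by (cases "v \<in> H - {h}") (auto simp: ctxt_def split: if_splits)
  qed
  have H: "antichain H" "h \<in> H" and H': "antichain H'" "h' \<in> H'"
    using C C' by (auto simp: ctxt_def)
  have "antichain ?H" by (rule antichain_compose) (use H H' in auto)
  moreover have "h @ h' \<in> (@) h ` H'" using H' by blast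
  moreover have "(H - {h}) \<union> (@) h ` H' \<noteq> {h @ h'}"
  proof -
    obtain k where "k \<in> H'" "k \<noteq> h'" using C' by (auto simp: ctxt_def)
    then show ?thesis by blast
  qed
  moreover have "zero_off ?H (plug t h t')"
    unfolding zero_off_def
  proof (intro allI impI)
    fix v assume v: "\<not> below ?H v"
    show "plug t h t' v = 0"
    proof (cases "prefix h v")
      case True
      then obtain w where w: "v = h @ w" by (auto simp: prefix_def)
      then have "\<not> below H' w" using v below_compose_at[OF H, of ?K w] by simp
      then show ?thesis using w C' by (simp add: graft_below ctxt_def zero_off_def)
    next
      case False
      have "\<not> below H v"
      proof
        assume "below H v"
        then obtain k u where "k \<in> H" "v = k @ u" by (rule belowE)
        moreover from this have "k \<noteq> h" using False by auto
        ultimately have "below ?H v" unfolding eq[symmetric] below_def by (auto intro: bexI[of _ k])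
        with v show False by blast
      qed
      then show ?thesis using False C by (simp add: graft_off ctxt_def zero_off_def)
    qed
  qed
  moreover have "sub (plug t h t') k \<in> typed A Y" if k: "k \<in> (H - {h}) \<union> (@) h ` H'" "k \<noteq> h @ h'" for k
  proof (cases "k \<in> H - {h}")
    case True
    then show ?thesis using sub_plug_ctxt[OF C True] C by (simp add: ctxt_def)
  next
    case False
    then obtain l where "l \<in> H'" "k = h @ l" using k(1) by blast
    moreover from this have "l \<noteq> h'" using k(2) by blast
    ultimately have "sub t' l \<in> typed A Y" using C' by (simp add: ctxt_def)
    moreover have "sub (plug t h t') k = sub t' l"
      unfolding \<open>k = h @ l\<close> sub_sub[symmetric] by simp
    ultimately show ?thesis by simp
  qed
  ultimately show ?thesis unfolding ctxt_def eq[symmetric] by blast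
qed

lemma plug_compose: "plug (plug t h t') (h @ h') u = plug t h (plug t' h' u)"
proof -
  have "plug (plug t h t') h w = plug t h w" for w
    by (rule ext) (simp add: graft_def)
  then show ?thesis by (simp add: plug_append)
qed

section \<open>Infinite composition of contexts\<close>

function limit_tree :: "(nat \<Rightarrow> tree) \<Rightarrow> (nat \<Rightarrow> node) \<Rightarrow> nat \<Rightarrow> tree" where
  "limit_tree t h i v =
     (if h i \<noteq> [] \<and> prefix (h i) v then limit_tree t h (Suc i) (drop (length (h i)) v) else t i v)"
  by pat_completeness auto
termination
  by (relation "measure (\<lambda>(t, h, i, v). length v)") (auto simp: prefix_def)

declare limit_tree.simps [simp del]

lemma limit_tree_unfold:
  assumes "h i \<noteq> []"
  shows "limit_tree t h i = plug (t i) (h i) (limit_tree t h (Suc i))"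
proof
  fix v
  show "limit_tree t h i v = plug (t i) (h i) (limit_tree t h (Suc i)) v"
    using assms
    by (subst limit_tree.simps) (auto simp: graft_off prefix_def graft_below)
qed

text \<open>The filled holes left by the infinite composition: those of every context, moved below
  the open holes passed before. For contexts they form an antichain, which the infinite branch
  through the open holes never meets.\<close>

inductive limit_hole :: "(nat \<Rightarrow> node) \<Rightarrow> (nat \<Rightarrow> node set) \<Rightarrow> nat \<Rightarrow> node \<Rightarrow> bool"
  for h H where
  here: "k \<in> H i \<Longrightarrow> k \<noteq> h i \<Longrightarrow> limit_hole h H i k"
| there: "limit_hole h H (Suc i) k \<Longrightarrow> limit_hole h H i (h i @ k)"

lemma typed_limit_tree:
  assumes Y: "closed_types A Y" and C: "\<And>i. ctxt A Y (t i) (h i) (H i)"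
  shows "limit_tree t h i \<in> typed A Y"
proof (rule typed_region[OF Y])
  note unfold = limit_tree_unfold[of h _ t, OF ctxt_not_Nil[OF C]]
  have anti: "antichain (H i)" and hH: "h i \<in> H i" for i using C by (simp_all add: ctxt_def)
  show "antichain {k. limit_hole h H i k}"
  proof -
    have "k = k'" if "limit_hole h H i k" "limit_hole h H i k'" "prefix k k'" for k k'
      using that
    proof (induction i k arbitrary: k' rule: limit_hole.induct)
      case (here k i)
      from here(3) show ?case
      proof cases
        case here': here
        then show ?thesis using here anti by (auto simp: antichain_def)
      next
        case (there l)
        then have "k = h i"
          using antichain_below_unique[OF anti here(1) hH here(4)] by simp
        with here show ?thesis by simp
      qed
    next
      case (there i k)
      from there(3) show ?case
      proof cases
        case here
        then have "k' = h i"
          using antichain_below_unique[OF anti hH here(1), of k'] append_prefixD[OF there(4)] by simp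
        with here show ?thesis by simp
      next
        case there': (there l)
        then show ?thesis using there by simp
      qed
    qed
    then show ?thesis by (auto simp: antichain_def)
  qed
  show "{k. limit_hole h H i k} \<noteq> {}"
  proof -
    obtain k where "k \<in> H i" "k \<noteq> h i" using C[of i] by (auto simp: ctxt_def)
    then show ?thesis using limit_hole.here by blast
  qed
  show "zero_off {k. limit_hole h H i k} (limit_tree t h i)"
    unfolding zero_off_def
  proof (intro allI impI)
    fix v assume "\<not> below {k. limit_hole h H i k} v"
    then show "limit_tree t h i v = 0"
    proof (induction "length v" arbitrary: i v rule: less_induct)
      case less
      show ?case
      proof (cases "prefix (h i) v")
        case True
        then obtain w where w: "v = h i @ w" by (auto simp: prefix_def)
        have "\<not> below {k. limit_hole h H (Suc i) k} w"
        proof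
          assume "below {k. limit_hole h H (Suc i) k} w"
          then obtain k where "limit_hole h H (Suc i) k" "prefix k w" by (auto simp: below_def)
          then have "limit_hole h H i (h i @ k)" "prefix (h i @ k) v"
            using w by (auto intro: limit_hole.there)
          then show False using less(2) unfolding below_def by blast
        qed
        moreover have "length w < length v" using w ctxt_not_Nil[OF C, of i] by simp
        ultimately have "limit_tree t h (Suc i) w = 0" using less(1) by blast
        then show ?thesis using w by (simp add: unfold[of i] graft_below)
      next
        case False
        have "\<not> below (H i) v"
        proof
          assume "below (H i) v"
          then obtain k where "k \<in> H i" "prefix k v" by (auto simp: below_def)
          moreover from this have "k \<noteq> h i" using False by auto
          ultimately show False using less(2) limit_hole.here by (auto simp: below_def)
        qed
        then show ?thesis using False C[of i] by (simp add: unfold[of i] graft_off ctxt_def zero_off_def)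
      qed
    qed
  qed
  fix k assume "k \<in> {k. limit_hole h H i k}"
  then have "limit_hole h H i k" by simp
  then show "sub (limit_tree t h i) k \<in> typed A Y"
  proof (induction i k rule: limit_hole.induct)
    case (here k i)
    then show ?case using C[of i] sub_plug_ctxt[OF C, of k i] by (simp add: unfold[of i] ctxt_def)
  next
    case (there i k)
    then show ?case
      using sub_sub[of "limit_tree t h i" "h i" k] by (simp add: unfold[of i])
  qed
qed

section \<open>Constant maps in sets of maps closed under composition\<close>

lemma funpow_eq_id_on:
  assumes "finite V" "inj_on g V" "g ` V \<subseteq> V"
  shows "\<exists>n. \<forall>z\<in>V. (g ^^ Suc n) z = z"
proof -
  have V: "(g ^^ i) z \<in> V" if "z \<in> V" for i z
    using that assms(3) by (induction i) auto
  have inj: "inj_on (g ^^ i) V" for i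
  proof (induction i)
    case (Suc i)
    have "inj_on g ((g ^^ i) ` V)" using V by (intro inj_on_subset[OF assms(2)]) auto
    then have "inj_on (g \<circ> g ^^ i) V" using comp_inj_on[OF Suc] by blast
    then show ?case by (simp only: funpow.simps)
  qed auto
  \<comment> \<open>Restricted to \<open>V\<close>, the iterates lie in a finite set of functions,
    so two of them coincide; injectivity cancels the smaller power. The remaining exponent is
    positive, so there is a factor to be modified later.\<close>
  let ?r = "\<lambda>i. restrict (g ^^ i) V"
  have "range ?r \<subseteq> V \<rightarrow>\<^sub>E V" using V by auto
  then have "finite (range ?r)" using assms(1) by (meson finite_PiE finite_subset)
  then have "\<not> inj ?r" using finite_imageD[of ?r UNIV] by auto
  then obtain i j where "?r i = ?r j" "i < j"
    unfolding inj_def by (metis linorder_neqE_nat)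
  define n where "n = j - i - 1"
  have j: "j = i + Suc n" using \<open>i < j\<close> by (simp add: n_def)
  have "(g ^^ Suc n) z = z" if z: "z \<in> V" for z
  proof -
    have "(g ^^ i) z = (g ^^ j) z" using \<open>?r i = ?r j\<close> z by (metis restrict_apply)
    also have "\<dots> = (g ^^ i) ((g ^^ Suc n) z)" unfolding j by (simp only: funpow_add comp_apply)
    finally show ?thesis using inj V z by (metis inj_on_def)
  qed
  then show ?thesis by blast
qed

text \<open>Take e in M with image V of minimal size. Then e (b z v) is injective in each
  argument on V, so z \<mapsto> e (b z v) permutes V and some iterate of it is the identity. If V had
  two elements, replacing v by the other one in just one factor of this iterate would give a
  map without fixed point.\<close>

lemma ex_constant_map:
  fixes M :: "('a \<Rightarrow> 'a) set"
  assumes fin: "finite Y" and ne: "Y \<noteq> {}"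
    and comp: "\<And>m m'. m \<in> M \<Longrightarrow> m' \<in> M \<Longrightarrow> m \<circ> m' \<in> M"
    and into: "\<And>m y. m \<in> M \<Longrightarrow> y \<in> Y \<Longrightarrow> m y \<in> Y"
    and fixp: "\<And>m. m \<in> M \<Longrightarrow> \<exists>z\<in>Y. m z = z"
    and left: "\<And>y. y \<in> Y \<Longrightarrow> b y \<in> M"
    and right: "\<And>y. y \<in> Y \<Longrightarrow> (\<lambda>x. b x y) \<in> M"
  shows "\<exists>e\<in>M. \<exists>c. \<forall>y\<in>Y. e y = c"
proof -
  obtain e where e: "e \<in> M" and min: "\<And>m. m \<in> M \<Longrightarrow> card (e ` Y) \<le> card (m ` Y)"
    using ne left ex_has_least_nat[of "\<lambda>m. m \<in> M" _ "\<lambda>m. card (m ` Y)"] by blast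
  let ?V = "e ` Y"
  have V: "finite ?V" "?V \<subseteq> Y" using fin e into by auto
  \<comment> \<open>Since \<open>e \<circ> m \<circ> e\<close> is again in \<open>M\<close>, its
    image is no smaller than \<open>?V\<close>, so \<open>e \<circ> m\<close> cannot identify two
    elements of \<open>?V\<close>.\<close>
  have inj: "inj_on (e \<circ> m) ?V" if "m \<in> M" for m
  proof (rule eq_card_imp_inj_on[OF V(1)])
    have "(e \<circ> m) \<circ> e \<in> M" using that e comp by blast
    then have "card ?V \<le> card ((e \<circ> m) ` ?V)" using min by (fastforce simp: image_comp)
    then show "card ((e \<circ> m) ` ?V) = card ?V" using card_image_le[OF V(1)] by (rule le_antisym[rotated])
  qed
  have bY: "b x y \<in> Y" if "x \<in> Y" "y \<in> Y" for x y
    using into[OF left[OF that(1)] that(2)] .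
  have "v = w" if v: "v \<in> ?V" and w: "w \<in> ?V" for v w
  proof -
    let ?g = "e \<circ> (\<lambda>z. b z v)" and ?g' = "e \<circ> (\<lambda>z. b z w)"
    have g: "?g \<in> M" "?g' \<in> M" using e right V v w comp by blast+
    have vY: "v \<in> Y" "w \<in> Y" using v w V by blast+
    have "?g ` ?V \<subseteq> ?V"
    proof (rule image_subsetI)
      fix z assume "z \<in> ?V"
      then have "b z v \<in> Y" using bY vY V by blast
      then show "?g z \<in> ?V" by simp
    qed
    then obtain n where n: "\<And>z. z \<in> ?V \<Longrightarrow> (?g ^^ Suc n) z = z"
      using funpow_eq_id_on[OF V(1) inj[OF right[OF vY(1)]]] by blast
    have "?g' \<circ> (?g ^^ i) \<in> M" for i
    proof (induction i)
      case 0
      show ?case unfolding funpow.simps(1) comp_id by (rule g(2))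
    next
      case (Suc i)
      then have "(?g' \<circ> (?g ^^ i)) \<circ> ?g \<in> M" using comp g by blast
      then show ?case by (simp only: funpow_Suc_right comp_assoc)
    qed
    \<comment> \<open>The modified word differs from the identity word only in its outermost factor.
      Its fixed point \<open>z\<close> turns out to lie in \<open>?V\<close>, so both words send
      \<open>z\<close> to itself and the two outermost factors agree at
      \<open>(?g ^^ n) z\<close>.\<close>
    then obtain z where z: "z \<in> Y" "?g' ((?g ^^ n) z) = z" using fixp by fastforce
    have iter: "(?g ^^ i) y \<in> Y" if "y \<in> Y" for i y
      using that into[OF g(1)] by (induction i) auto
    have "b ((?g ^^ n) z) w \<in> Y" using bY iter[OF z(1)] vY by blast
    then have zV: "z \<in> ?V" using z(2) by (metis comp_apply imageI)
    then have "?g ((?g ^^ n) z) = z" using n[OF zV] by simp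
    then have "(e \<circ> b ((?g ^^ n) z)) v = (e \<circ> b ((?g ^^ n) z)) w" using z(2) by simp
    then show "v = w" using inj[OF left[OF iter[OF z(1)]]] v w by (metis inj_on_def)
  qed
  then show ?thesis using e by blast
qed

section \<open>The action of contexts on types\<close>

definition ctxt_map :: "pta \<Rightarrow> nat set set \<Rightarrow> (nat set \<Rightarrow> nat set) \<Rightarrow> bool" where
  "ctxt_map A Y m \<longleftrightarrow>
     (\<exists>t h H. ctxt A Y t h H \<and> (\<forall>u\<in>typed A Y. ty A (plug t h u) = m (ty A u)))"

lemma ex_typed: "minimal_types A Y \<Longrightarrow> y \<in> Y \<Longrightarrow> \<exists>u\<in>typed A Y. ty A u = y"
  by (auto simp: minimal_types_def typed_def)

lemma ctxt_map_into:
  assumes Y: "minimal_types A Y" and "ctxt_map A Y m" "y \<in> Y"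
  shows "m y \<in> Y"
proof -
  obtain u where u: "u \<in> typed A Y" "ty A u = y" using ex_typed[OF Y] assms(3) by blast
  obtain t h H where C: "ctxt A Y t h H" "ty A (plug t h u) = m y"
    using assms(2) u unfolding ctxt_map_def by blast
  have "plug t h u \<in> typed A Y"
    using typed_plug[OF _ C(1) u(1)] Y by (simp add: minimal_types_def)
  then show ?thesis using C(2) by (simp add: typed_def)
qed

lemma ctxt_map_comp:
  assumes Y: "minimal_types A Y" and "ctxt_map A Y m" "ctxt_map A Y m'"
  shows "ctxt_map A Y (m \<circ> m')"
proof -
  obtain t h H where C: "ctxt A Y t h H" "\<forall>u\<in>typed A Y. ty A (plug t h u) = m (ty A u)"
    using assms(2) by (auto simp: ctxt_map_def)
  obtain t' h' H' where C': "ctxt A Y t' h' H'" "\<forall>u\<in>typed A Y. ty A (plug t' h' u) = m' (ty A u)"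
    using assms(3) by (auto simp: ctxt_map_def)
  have "ty A (plug (plug t h t') (h @ h') u) = (m \<circ> m') (ty A u)" if u: "u \<in> typed A Y" for u
    using C(2) C'(2) u typed_plug[OF _ C'(1) u] Y by (simp add: plug_compose minimal_types_def)
  then show ?thesis unfolding ctxt_map_def using ctxt_compose[OF C(1) C'(1)] by blast
qed

text \<open>The context nested into itself forever is a tree that reproduces itself when plugged
  into the context, so its type is fixed.\<close>

lemma ctxt_map_fixpoint:
  assumes Y: "minimal_types A Y" and "ctxt_map A Y m"
  shows "\<exists>z\<in>Y. m z = z"
proof -
  obtain t h H where C: "ctxt A Y t h H" "\<forall>u\<in>typed A Y. ty A (plug t h u) = m (ty A u)"
    using assms(2) by (auto simp: ctxt_map_def)
  let ?u = "limit_tree (\<lambda>_. t) (\<lambda>_. h)"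
  have const: "?u i v = ?u j v" for i j v
  proof (induction "length v" arbitrary: i j v rule: less_induct)
    case less
    have "?u (Suc i) (drop (length h) v) = ?u (Suc j) (drop (length h) v)" if "prefix h v" "h \<noteq> []"
      using that by (intro less) (auto simp: prefix_def)
    then show ?case by (subst (1 2) limit_tree.simps) simp
  qed
  then have eq: "?u i = ?u j" for i j by blast
  have "?u 0 \<in> typed A Y"
    using typed_limit_tree[of A Y "\<lambda>_. t" "\<lambda>_. h" "\<lambda>_. H"] C(1) Y by (simp add: minimal_types_def)
  moreover have "?u 0 = plug t h (?u 0)"
    using limit_tree_unfold[of "\<lambda>_. h" 0 "\<lambda>_. t", OF ctxt_not_Nil[OF C(1)]] eq[of "Suc 0" 0] by simp
  ultimately have "m (ty A (?u 0)) = ty A (?u 0)" using C(2) by metis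
  then show ?thesis using \<open>?u 0 \<in> typed A Y\<close> by (auto simp: typed_def)
qed

definition node_tree :: "nat \<Rightarrow> tree \<Rightarrow> tree \<Rightarrow> tree" where
  "node_tree a t u v = (case v of [] \<Rightarrow> a | b # w \<Rightarrow> if b then u w else t w)"

lemma sub_node_tree [simp]:
  "sub (node_tree a t u) [False] = t" "sub (node_tree a t u) [True] = u"
  by (simp_all add: fun_eq_iff sub_apply node_tree_def)

lemma antichain_children: "antichain {[False], [True]}"
  by (simp add: antichain_def)

lemma below_children: "below {[False], [True]} v \<longleftrightarrow> v \<noteq> []"
  by (cases v) (auto simp: below_def)

lemma node_tree_off: "\<not> below {[False], [True]} v \<Longrightarrow> node_tree 0 t u v = 0"
  by (simp add: below_children node_tree_def)

lemma plug_node_tree: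
  "plug (node_tree a t u) [False] w = node_tree a w u"
  "plug (node_tree a t u) [True] w = node_tree a t w"
proof -
  have "plug (node_tree a t u) [b] w v = (case v of [] \<Rightarrow> a | c # x \<Rightarrow> if b = c then w x else node_tree a t u v)"
    for b v
    using graft_below[of "{[b]}" "[b]" "node_tree a t u" "\<lambda>_. w"]
    by (cases v) (auto simp: graft_off node_tree_def)
  then show "plug (node_tree a t u) [False] w = node_tree a w u" "plug (node_tree a t u) [True] w = node_tree a t w"
    by (auto simp: fun_eq_iff node_tree_def split: list.splits)
qed

lemma ty_node_tree_cong:
  "ty A t = ty A t' \<Longrightarrow> ty A u = ty A u' \<Longrightarrow> ty A (node_tree 0 t u) = ty A (node_tree 0 t' u')"
  by (rule ty_cong[OF antichain_children]) (auto simp: node_tree_off)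

lemma ctxt_node_tree:
  assumes "t \<in> typed A Y"
  shows "ctxt A Y (node_tree 0 t u) [True] {[False], [True]}" "ctxt A Y (node_tree 0 u t) [False] {[False], [True]}"
  using assms by (auto simp: ctxt_def antichain_children zero_off_def node_tree_off)

text \<open>The operation needed for \<open>ex_constant_map\<close> joins two subtrees under a root
  labelled 0. It is an operation on types because of \<open>ty_node_tree_cong\<close>, and fixing
  one argument gives a context whose open hole is the other child.\<close>

lemma ex_constant_ctxt:
  assumes Y: "minimal_types A Y"
  shows "\<exists>t h H c. ctxt A Y t h H \<and> (\<forall>u\<in>typed A Y. ty A (plug t h u) = c)"
proof -
  define rep where "rep y = (SOME u. u \<in> typed A Y \<and> ty A u = y)" for y
  have rep: "rep y \<in> typed A Y" "ty A (rep y) = y" if "y \<in> Y" for y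
    using someI_ex[of "\<lambda>u. u \<in> typed A Y \<and> ty A u = y"] ex_typed[OF Y that] unfolding rep_def by blast+
  have rep_ty: "ty A (rep (ty A u)) = ty A u" if "u \<in> typed A Y" for u
    using rep(2) that by (simp add: typed_def)
  define b where "b y z = ty A (node_tree 0 (rep y) (rep z))" for y z
  have "ctxt_map A Y (b y)" if "y \<in> Y" for y
  proof -
    have "ty A (plug (node_tree 0 (rep y) zero_tree) [True] u) = b y (ty A u)" if "u \<in> typed A Y" for u
      unfolding plug_node_tree b_def using rep_ty[OF that] by (intro ty_node_tree_cong) auto
    then show ?thesis unfolding ctxt_map_def using ctxt_node_tree(1)[OF rep(1)[OF \<open>y \<in> Y\<close>]] by blast
  qed
  moreover have "ctxt_map A Y (\<lambda>x. b x y)" if "y \<in> Y" for y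
  proof -
    have "ty A (plug (node_tree 0 zero_tree (rep y)) [False] u) = b (ty A u) y" if "u \<in> typed A Y" for u
      unfolding plug_node_tree b_def using rep_ty[OF that] by (intro ty_node_tree_cong) auto
    then show ?thesis unfolding ctxt_map_def using ctxt_node_tree(2)[OF rep(1)[OF \<open>y \<in> Y\<close>]] by blast
  qed
  ultimately have "\<exists>e\<in>{m. ctxt_map A Y m}. \<exists>c. \<forall>y\<in>Y. e y = c"
    using Y ctxt_map_comp[OF Y] ctxt_map_into[OF Y] ctxt_map_fixpoint[OF Y]
    by (intro ex_constant_map[of Y _ b]) (auto simp: minimal_types_def)
  then obtain m c where "ctxt_map A Y m" and c: "\<forall>y\<in>Y. m y = c" by blast
  then obtain t h H where "ctxt A Y t h H" "\<forall>u\<in>typed A Y. ty A (plug t h u) = m (ty A u)"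
    unfolding ctxt_map_def by blast
  then have "ctxt A Y t h H \<and> (\<forall>u\<in>typed A Y. ty A (plug t h u) = c)"
    using c by (simp add: typed_def)
  then show ?thesis by blast
qed

text \<open>Constancy in the hole \<open>h\<close>, in a form where only the types in the holes
  \<open>P\<close> are prescribed and not the trees. This allows \<open>P\<close> to be filled later
  with copies of the very tree under construction.\<close>

definition absorbs :: "pta \<Rightarrow> nat set set \<Rightarrow> node set \<Rightarrow> node \<Rightarrow> nat set \<Rightarrow> bool" where
  "absorbs A Y P h y \<longleftrightarrow>
     (\<forall>r r'. zero_off (insert h P) r \<and> zero_off (insert h P) r' \<and>
       (\<forall>p\<in>P. sub r p \<in> marked \<and> ty A (sub r p) = y \<and> sub r' p \<in> marked \<and> ty A (sub r' p) = y) \<and>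
       sub r h \<in> typed A Y \<and> sub r' h \<in> typed A Y \<longrightarrow> ty A r = ty A r')"

text \<open>Absorption has to hold for all y at once, since the type of the tree that
  is going to be put into the holes P is known only after P has been chosen.\<close>

lemma ex_absorbs:
  assumes Y: "minimal_types A Y" and "finite F" "F \<subseteq> Y"
  shows "\<exists>P h. antichain (insert h P) \<and> h \<notin> P \<and> P \<noteq> {} \<and> (\<forall>y\<in>F. absorbs A Y P h y)"
  using assms(2,3)
proof (induction F rule: finite_induct)
  case empty
  have "antichain (insert [False] {[True]})" using antichain_children by simp
  then show ?case by blast
next
  case (insert y F)
  then obtain P h where P: "antichain (insert h P)" "h \<notin> P" "P \<noteq> {}" "\<forall>y\<in>F. absorbs A Y P h y"
    by blast
  have y: "y \<in> Y" and cl: "closed_types A Y" using insert Y by (auto simp: minimal_types_def)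
  obtain t k H c where C: "ctxt A Y t k H" and c: "\<forall>u\<in>typed A Y. ty A (plug t k u) = c"
    using ex_constant_ctxt[OF Y] by blast
  have H: "antichain H" "k \<in> H" "zero_off H t" using C by (auto simp: ctxt_def)
  \<comment> \<open>Each filled hole \<open>l\<close> of the constant context is dissolved into
    holes \<open>K l\<close>. If these all receive type \<open>y\<close>, then \<open>l\<close>
    regains its original type and the constant context is restored.\<close>
  define conn where "conn K l \<longleftrightarrow> antichain K \<and> K \<noteq> {} \<and>
    (\<forall>r. zero_off K r \<and> (\<forall>k\<in>K. sub r k \<in> marked \<and> ty A (sub r k) = y) \<longrightarrow> ty A r = ty A (sub t l))"
    for K l
  have "\<exists>K. conn K l" if "l \<in> H - {k}" for l
  proof -
    have "ty A (sub t l) \<in> Y" using C that by (auto simp: ctxt_def typed_def)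
    then show ?thesis unfolding conn_def by (rule connect_types[OF Y y])
  qed
  then obtain K where K: "\<And>l. l \<in> H - {k} \<Longrightarrow> conn (K l) l" by metis
  let ?K = "\<lambda>l. if l = k then insert h P else K l"
  let ?P = "{l @ x |l x. l \<in> H - {k} \<and> x \<in> K l} \<union> (@) k ` P"
  let ?H = "{l @ x |l x. l \<in> H \<and> x \<in> ?K l}"
  have eq: "insert (k @ h) ?P = ?H"
    using H(2) by (auto split: if_splits)
  have "antichain (insert (k @ h) ?P)"
    unfolding eq
  proof (rule antichain_compose[OF H(1)])
    fix l assume "l \<in> H"
    then show "antichain (?K l)" using P(1) K[of l] by (auto simp: conn_def)
  qed
  moreover have "k @ h \<notin> ?P"
  proof
    assume "k @ h \<in> ?P"
    then obtain l x where l: "l \<in> H" "l \<noteq> k" "k @ h = l @ x" using P(2) by auto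
    have "prefix l (k @ h)" unfolding l(3) by simp
    then show False using antichain_below_unique[OF H(1) l(1) H(2), of "k @ h"] l(2) by simp
  qed
  moreover have "?P \<noteq> {}" using P(3) by blast
  moreover have "absorbs A Y ?P (k @ h) z" if z: "z \<in> insert y F" for z
    unfolding absorbs_def eq
  proof (intro allI impI, elim conjE)
    fix r r'
    assume r: "zero_off ?H r" and r': "zero_off ?H r'"
      and rP: "\<forall>p\<in>?P. sub r p \<in> marked \<and> ty A (sub r p) = z \<and> sub r' p \<in> marked \<and> ty A (sub r' p) = z"
      and rh: "sub r (k @ h) \<in> typed A Y" and rh': "sub r' (k @ h) \<in> typed A Y"
    note z_off = zero_off_compose[OF H(1) r] zero_off_compose[OF H(1) r']
    have off: "r v = 0" "r' v = 0" "t v = 0" if "\<not> below H v" for v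
      using below_compose_off[OF that, of ?K] r r' that H(3) by (simp_all add: zero_off_def)
    have kP: "sub (sub r k) p \<in> marked \<and> ty A (sub (sub r k) p) = z \<and>
        sub (sub r' k) p \<in> marked \<and> ty A (sub (sub r' k) p) = z" if "p \<in> P" for p
      using rP that by auto
    have k_off: "zero_off (insert h P) (sub r k)" "zero_off (insert h P) (sub r' k)"
      using z_off[OF H(2)] by simp_all
    have lK: "sub (sub r l) x \<in> marked \<and> ty A (sub (sub r l) x) = z \<and>
        sub (sub r' l) x \<in> marked \<and> ty A (sub (sub r' l) x) = z" if "l \<in> H - {k}" "x \<in> K l" for l x
      using rP that by auto
    have l_off: "zero_off (K l) (sub r l)" "zero_off (K l) (sub r' l)" if "l \<in> H - {k}" for l
      using z_off[of l] that by simp_all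
    \<comment> \<open>For an old \<open>z\<close>, the difference at \<open>k @ h\<close> is
      absorbed already below \<open>k\<close>, and the other holes of \<open>H\<close> receive equal
      types in both trees. For \<open>z = y\<close>, the restored context around \<open>k\<close>
      forces the type \<open>c\<close>.\<close>
    show "ty A r = ty A r'"
    proof (cases "z = y")
      case False
      then have zF: "absorbs A Y P h z" using z P(4) by blast
      show ?thesis
      proof (rule ty_cong[OF H(1)])
        fix l assume l: "l \<in> H"
        show "ty A (sub r l) = ty A (sub r' l)"
        proof (cases "l = k")
          case True
          show ?thesis
            unfolding True
            by (rule zF[unfolded absorbs_def, rule_format]) (use k_off kP rh rh' in simp)
        next
          case False
          show ?thesis
          proof (rule ty_cong)
            show "antichain (K l)" using K[of l] l False by (simp add: conn_def)
          qed (use l_off[of l] lK[of l] l False in \<open>simp_all add: zero_off_def\<close>)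
        qed
      qed (simp add: off)
    next
      case True
      have "ty A s = c"
        if s_off: "\<And>v. \<not> below H v \<Longrightarrow> s v = 0"
          and l: "\<And>l. l \<in> H - {k} \<Longrightarrow> ty A (sub s l) = ty A (sub t l)"
          and k: "zero_off (insert h P) (sub s k)" "\<And>p. p \<in> insert h P \<Longrightarrow> sub (sub s k) p \<in> typed A Y" for s
      proof -
        have "sub s k \<in> typed A Y"
          by (rule typed_region[OF cl P(1) _ k]) auto
        then have "ty A (plug t k (sub s k)) = c" using c by blast
        moreover have "ty A s = ty A (plug t k (sub s k))"
        proof (rule ty_cong[OF H(1)])
          fix v assume v: "\<not> below H v"
          then have "\<not> prefix k v" using H(2) by (auto simp: below_def)
          then show "s v = plug t k (sub s k) v" using v off(3) s_off by (simp add: graft_off)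
        next
          fix l assume "l \<in> H"
          then show "ty A (sub s l) = ty A (sub (plug t k (sub s k)) l)"
            using l sub_plug_ctxt[OF C, of l] by (cases "l = k") auto
        qed
        ultimately show ?thesis by simp
      qed
      note const = this
      have "ty A (sub r l) = ty A (sub t l)" "ty A (sub r' l) = ty A (sub t l)" if l: "l \<in> H - {k}" for l
        using K[OF l, unfolded conn_def, THEN conjunct2, THEN conjunct2, rule_format]
          l_off[OF l] lK[OF l] True by blast+
      moreover have "sub (sub r k) p \<in> typed A Y" "sub (sub r' k) p \<in> typed A Y" if "p \<in> insert h P" for p
        using that kP[of p] rh rh' True y by (auto simp: typed_def)
      ultimately show ?thesis using const[of r] const[of r'] off k_off by simp
    qed
  qed
  ultimately show ?case by (intro exI[of _ ?P] exI[of _ "k @ h"]) blast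
qed

section \<open>Insensitive trees\<close>

text \<open>Words over \<open>P\<close> followed by \<open>h\<close>: the copies of \<open>h\<close>
  that remain when a tree with holes \<open>P\<close> and \<open>h\<close> is put into its own holes
  \<open>P\<close> forever.\<close>

inductive_set star_holes :: "node set \<Rightarrow> node \<Rightarrow> node set" for P h where
  base: "h \<in> star_holes P h"
| step: "p \<in> P \<Longrightarrow> k \<in> star_holes P h \<Longrightarrow> p @ k \<in> star_holes P h"

text \<open>An antichain is a prefix code: a hole comparable with a word starting with
  \<open>p\<close> has a first factor comparable with \<open>p\<close>, hence equal to
  \<open>p\<close>.\<close>

lemma star_holes_cases_prefix:
  assumes "antichain (insert h P)" "k \<in> star_holes P h" "p \<in> P" "h \<notin> P" "prefix k (p @ v) \<or> prefix (p @ v) k"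
  obtains l where "k = p @ l" "l \<in> star_holes P h"
  using assms(2)
proof cases
  case base
  have "h = p"
    using assms(5) unfolding base
  proof
    assume "prefix h (p @ v)"
    then show ?thesis using antichain_below_unique[OF assms(1), of h p "p @ v"] assms(3) by simp
  next
    assume "prefix (p @ v) h"
    then show ?thesis
      using antichain_below_unique[OF assms(1), of h p h] assms(3) append_prefixD[of p v h] by simp
  qed
  with assms show ?thesis by simp
next
  case (step p' l)
  have "p' = p"
    using assms(5) unfolding step(1)
  proof
    assume "prefix (p' @ l) (p @ v)"
    then show ?thesis
      using antichain_below_unique[OF assms(1), of p' p "p @ v"] assms(3) step append_prefixD[of p' l]
      by simp
  next
    assume "prefix (p @ v) (p' @ l)"
    then show ?thesis
      using antichain_below_unique[OF assms(1), of p' p "p' @ l"] assms(3) step append_prefixD[of p v]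
      by simp
  qed
  with step that show ?thesis by blast
qed

lemma antichain_star_holes:
  assumes P: "antichain (insert h P)" "h \<notin> P"
  shows "antichain (star_holes P h)"
proof -
  have "k = k'" if "k \<in> star_holes P h" "k' \<in> star_holes P h" "prefix k k'" for k k'
    using that
  proof (induction k arbitrary: k' rule: star_holes.induct)
    case base
    from base(1) show ?case
    proof cases
      case (step p l)
      then have "h = p"
        using antichain_below_unique[OF P(1), of h p k'] base(2) by simp
      with step P show ?thesis by simp
    qed simp
  next
    case (step p k)
    obtain l where "k' = p @ l" "l \<in> star_holes P h"
      using star_holes_cases_prefix[OF P(1) step(4) step(1) P(2), of k] step(5) by auto
    then show ?case using step by simp
  qed
  then show ?thesis by (auto simp: antichain_def)
qed

lemma below_star_holes:
  assumes P: "antichain (insert h P)" "h \<notin> P" and p: "p \<in> P"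
  shows "below (star_holes P h) (p @ v) \<longleftrightarrow> below (star_holes P h) v"
proof
  assume "below (star_holes P h) (p @ v)"
  then obtain k where k: "k \<in> star_holes P h" "prefix k (p @ v)" by (auto simp: below_def)
  obtain l where "k = p @ l" "l \<in> star_holes P h"
    using star_holes_cases_prefix[OF P(1) k(1) p P(2), of v] k(2) by auto
  then show "below (star_holes P h) v" using k(2) by (auto simp: below_def)
next
  assume "below (star_holes P h) v"
  then obtain k where "k \<in> star_holes P h" "prefix k v" by (auto simp: below_def)
  then have "p @ k \<in> star_holes P h" "prefix (p @ k) (p @ v)"
    using p by (auto intro: star_holes.step)
  then show "below (star_holes P h) (p @ v)" unfolding below_def by blast
qed

definition star_tree :: "node set \<Rightarrow> node \<Rightarrow> tree \<Rightarrow> tree" where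
  "star_tree P h t = graft (star_holes P h) zero_tree (\<lambda>_. t)"

lemma sub_star_tree_step:
  assumes P: "antichain (insert h P)" "h \<notin> P" and p: "p \<in> P"
  shows "sub (star_tree P h t) p = star_tree P h t"
proof
  fix v
  note anti = antichain_star_holes[OF P]
  show "sub (star_tree P h t) p v = star_tree P h t v"
  proof (cases "below (star_holes P h) v")
    case True
    then obtain k w where k: "k \<in> star_holes P h" "v = k @ w" by (rule belowE)
    then have "p @ k \<in> star_holes P h" using p by (auto intro: star_holes.step)
    then show ?thesis
      using k graft_below[OF anti, of "p @ k" zero_tree "\<lambda>_. t" w]
      by (simp add: star_tree_def sub_apply graft_below[OF anti])
  next
    case False
    then show ?thesis
      using below_star_holes[OF P p, of v] by (simp add: star_tree_def sub_apply graft_off)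
  qed
qed

lemma sub_star_tree_hole:
  "antichain (insert h P) \<Longrightarrow> h \<notin> P \<Longrightarrow> k \<in> star_holes P h \<Longrightarrow> sub (star_tree P h t) k = t"
  unfolding star_tree_def by (intro sub_graft antichain_star_holes)

lemma zero_off_star_tree: "zero_off (insert h P) (star_tree P h t)"
  unfolding zero_off_def
proof (intro allI impI)
  fix v assume v: "\<not> below (insert h P) v"
  have "\<not> below (star_holes P h) v"
  proof
    assume "below (star_holes P h) v"
    then obtain k where "k \<in> star_holes P h" "prefix k v" by (auto simp: below_def)
    then have "below (insert h P) v"
      by (cases rule: star_holes.cases) (auto simp: below_def dest: append_prefixD)
    with v show False ..
  qed
  then show "star_tree P h t v = 0" by (simp add: star_tree_def graft_off)
qed

lemma typed_star_tree:
  assumes "closed_types A Y" "antichain (insert h P)" "h \<notin> P" "t \<in> typed A Y"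
  shows "star_tree P h t \<in> typed A Y"
proof (rule typed_region[OF assms(1) antichain_star_holes[OF assms(2,3)]])
  show "star_holes P h \<noteq> {}" using star_holes.base by blast
  show "zero_off (star_holes P h) (star_tree P h t)" unfolding star_tree_def by (rule zero_off_graft)
qed (use assms sub_star_tree_hole in simp)

text \<open>The star tree contains itself at every position in \<open>P\<close>, so absorption for
  its own type settles the hole \<open>h\<close>. A deeper hole lies in such a copy, whose type is
  unchanged by induction.\<close>

lemma star_tree_insensitive:
  assumes Y: "closed_types A Y" and P: "antichain (insert h P)" "h \<notin> P" and t: "t \<in> typed A Y"
    and abs: "absorbs A Y P h (ty A (star_tree P h t))"
    and "k \<in> star_holes P h" and u: "u \<in> typed A Y"
  shows "ty A (plug (star_tree P h t) k u) = ty A (star_tree P h t)"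
  using assms(6)
proof (induction k rule: star_holes.induct)
  case base
  let ?s = "star_tree P h t"
  have s: "?s \<in> marked" using typed_star_tree[OF Y P t] by (rule typed_marked)
  have p: "sub (plug ?s h u) p = ?s" "sub ?s p = ?s" if "p \<in> P" for p
  proof -
    have "p \<noteq> h" using that P(2) by blast
    then show "sub (plug ?s h u) p = ?s" "sub ?s p = ?s"
      using sub_plug_antichain[OF P(1), of h p ?s u] sub_star_tree_step[OF P that] that by simp_all
  qed
  show ?case
  proof (rule abs[unfolded absorbs_def, rule_format], intro conjI ballI)
    show "zero_off (insert h P) (plug ?s h u)" by (intro zero_off_plug zero_off_star_tree) simp
    show "sub ?s h \<in> typed A Y" using sub_star_tree_hole[OF P star_holes.base] t by simp
  qed (use p s u zero_off_star_tree in simp_all)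
next
  case (step p k)
  then show ?case
    using sub_star_tree_step[OF P step(1)] by (simp add: plug_append ty_plug_same)
qed

text \<open>The star tree \<open>s\<close> is insensitive at its holes, but carries there a tree
  \<open>t\<close> of some other type. So \<open>t\<close> is replaced by a tree \<open>t'\<close>
  of the same type that is built from copies of \<open>s\<close>. The result \<open>s'\<close> keeps
  the type of \<open>s\<close>, and the holes inside the copies of \<open>t'\<close> carry
  \<open>s\<close>.\<close>

lemma ex_insensitive_tree:
  assumes Y: "minimal_types A Y"
  shows "\<exists>s H. s \<in> typed A Y \<and> H \<noteq> {} \<and> (\<forall>h\<in>H. ctxt A Y s h H \<and> ty A (sub s h) = ty A s \<and>
    (\<forall>u\<in>typed A Y. ty A (plug s h u) = ty A s))"
proof -
  have cl: "closed_types A Y" and fin: "finite Y" using Y by (auto simp: minimal_types_def)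
  obtain P h where P: "antichain (insert h P)" "h \<notin> P" and "P \<noteq> {}"
    and abs: "\<forall>y\<in>Y. absorbs A Y P h y" using ex_absorbs[OF Y fin] by blast
  have "Y \<noteq> {}" using Y by (simp add: minimal_types_def)
  then obtain t where t: "t \<in> typed A Y" using ex_typed[OF Y] by blast
  define s where "s = star_tree P h t"
  have s: "s \<in> typed A Y" unfolding s_def by (rule typed_star_tree[OF cl P t])
  have yY: "ty A s \<in> Y" "ty A t \<in> Y" using s t by (simp_all add: typed_def)
  obtain K where K: "antichain K" "K \<noteq> {}"
    "\<And>r. zero_off K r \<Longrightarrow> \<forall>k\<in>K. sub r k \<in> marked \<and> ty A (sub r k) = ty A s \<Longrightarrow> ty A r = ty A t"
    using connect_types[OF Y yY] by blast
  define t' where "t' = graft K zero_tree (\<lambda>_. s)"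
  have sub_t': "sub t' k = s" if "k \<in> K" for k using K(1) that by (simp add: t'_def sub_graft)
  have t'_off: "zero_off K t'" unfolding t'_def by (rule zero_off_graft)
  have t': "t' \<in> typed A Y" by (rule typed_region[OF cl K(1,2) t'_off]) (simp add: sub_t' s)
  have ty_t': "ty A t' = ty A t" using K(3)[OF t'_off] sub_t' s typed_marked by simp
  define s' where "s' = star_tree P h t'"
  have s': "s' \<in> typed A Y" unfolding s'_def by (rule typed_star_tree[OF cl P t'])
  note anti = antichain_star_holes[OF P]
  have sub_s': "sub s' k = t'" if "k \<in> star_holes P h" for k
    unfolding s'_def using P that by (rule sub_star_tree_hole)
  have ty_s': "ty A s' = ty A s"
  proof (rule ty_cong[OF anti])
    fix k assume "k \<in> star_holes P h"
    then show "ty A (sub s' k) = ty A (sub s k)"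
      using sub_star_tree_hole[OF P] ty_t' by (simp add: s_def s'_def)
  qed (simp add: s_def s'_def star_tree_def graft_off)
  define H where "H = {k @ l |k l. k \<in> star_holes P h \<and> l \<in> K}"
  have H: "antichain H" unfolding H_def by (rule antichain_compose[OF anti K(1)])
  have sub_H: "sub s' x = s" if xH: "x \<in> H" for x
  proof -
    obtain k l where x: "x = k @ l" and kl: "k \<in> star_holes P h" "l \<in> K" using xH unfolding H_def by blast
    show ?thesis unfolding x sub_sub[symmetric] sub_s'[OF kl(1)] by (rule sub_t'[OF kl(2)])
  qed
  have H_off: "zero_off H s'"
    unfolding zero_off_def
  proof (intro allI impI)
    fix v assume v: "\<not> below H v"
    show "s' v = 0"
    proof (cases "below (star_holes P h) v")
      case True
      then obtain k w where k: "k \<in> star_holes P h" "v = k @ w" by (rule belowE)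
      then have "\<not> below K w" using v below_compose_at[OF anti k(1), of "\<lambda>_. K"] by (simp add: H_def)
      then show ?thesis
        using t'_off k(2) sub_s'[OF k(1)] by (metis sub_apply zero_off_def)
    next
      case False
      then show ?thesis by (simp add: s'_def star_tree_def graft_off)
    qed
  qed
  \<comment> \<open>Two distinct holes are exhibited because a context must have a filled hole
    besides the open one. This is where \<open>P \<noteq> {}\<close> is needed.\<close>
  obtain l p where l: "l \<in> K" and p: "p \<in> P" using K(2) \<open>P \<noteq> {}\<close> by blast
  have "h @ l \<in> H" unfolding H_def using l star_holes.base[of h P] by blast
  moreover have "p @ h \<in> star_holes P h" using star_holes.step[OF p star_holes.base] .
  then have "(p @ h) @ l \<in> H" unfolding H_def using l by blast
  ultimately have two: "h @ l \<in> H" "p @ h @ l \<in> H" by simp_all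
  have "p \<noteq> []"
  proof
    assume "p = []"
    then have "p = h" using antichainD[OF P(1), of p h] p by simp
    then show False using p P(2) by blast
  qed
  then have "h @ l \<noteq> p @ h @ l"
    by (metis append_self_conv2 append_same_eq append_assoc)
  then have "H \<noteq> {x}" for x using two by blast
  then have "ctxt A Y s' x H" if "x \<in> H" for x
    unfolding ctxt_def using H H_off that sub_H s by simp
  moreover have "ty A (plug s' x u) = ty A s'" if xH: "x \<in> H" and u: "u \<in> typed A Y" for x u
  proof -
    obtain k l where x: "x = k @ l" "k \<in> star_holes P h" "l \<in> K" using xH unfolding H_def by blast
    have "plug t' l u \<in> typed A Y"
    proof (rule typed_region[OF cl K(1,2) zero_off_plug[OF t'_off x(3)]])
      fix l' assume "l' \<in> K"
      then show "sub (plug t' l u) l' \<in> typed A Y"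
        using sub_plug_antichain[OF K(1) x(3), of l' t'] sub_t' s u by (cases "l' = l") auto
    qed
    then have "ty A (plug s' k (plug t' l u)) = ty A s'"
      using star_tree_insensitive[OF cl P t' _ x(2)] abs yY(1) ty_s' unfolding s'_def by simp
    then show ?thesis using x sub_s' by (simp add: plug_append)
  qed
  ultimately show ?thesis
    using s' two(1) sub_H ty_s' by (intro exI[of _ s'] exI[of _ H] conjI ballI) blast+
qed

section \<open>Many runs\<close>

lemma length_drop_prefix: "h \<noteq> [] \<Longrightarrow> prefix h v \<Longrightarrow> length (drop (length h) v) < length v"
  by (auto simp: prefix_def)

text \<open>The nesting passes states along: at a hole, the computation continues with the run
  chosen for the state that \<open>\<phi> p\<close> has reached there.\<close>

function nest :: "node set \<Rightarrow> (nat \<Rightarrow> node \<Rightarrow> nat) \<Rightarrow> nat \<Rightarrow> node \<Rightarrow> nat" where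
  "nest H \<phi> p v =
     (let h = (THE h. h \<in> H \<and> prefix h v)
      in if below H v \<and> h \<noteq> [] \<and> prefix h v then nest H \<phi> (\<phi> p h) (drop (length h) v) else \<phi> p v)"
  by pat_completeness auto
termination
  by (relation "measure (\<lambda>(H, \<phi>, p, v). length v)")
    (rule wf_measure, simp only: in_measure prod.case, blast intro: length_drop_prefix)

declare nest.simps [simp del]

lemma nest_unfold:
  assumes "antichain H" "[] \<notin> H"
  shows "nest H \<phi> p = graft H (\<phi> p) (\<lambda>h. nest H \<phi> (\<phi> p h))"
proof
  fix v
  show "nest H \<phi> p v = graft H (\<phi> p) (\<lambda>h. nest H \<phi> (\<phi> p h)) v"
  proof (cases "below H v")
    case True
    then obtain h u where h: "h \<in> H" "v = h @ u" by (rule belowE)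
    then have "(THE h. h \<in> H \<and> prefix h v) = h"
      using antichain_below_unique[OF assms(1)] by (intro the_equality) auto
    then show ?thesis
      using True h assms by (subst nest.simps) (auto simp: Let_def graft_below)
  next
    case False
    then show ?thesis by (subst nest.simps) (simp add: graft_off)
  qed
qed

text \<open>Nesting runs on an insensitive tree s into its own holes gives a computation on the
  zero tree. If that one cannot be accepting, it has a rejecting branch that passes
  through infinitely many holes. Plugging s recursively into just these holes gives a tree u of
  the type of s; it has accepting runs that agree with the rejecting branch arbitrarily long.\<close>

lemma ex_many_runs_at:
  assumes cl: "closed_types A Y" and s: "s \<in> typed A Y" and "H \<noteq> {}"
    and C: "\<And>h. h \<in> H \<Longrightarrow> ctxt A Y s h H"
    and ty_H: "\<And>h. h \<in> H \<Longrightarrow> ty A (sub s h) = ty A s"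
    and ins: "\<And>h u. h \<in> H \<Longrightarrow> u \<in> typed A Y \<Longrightarrow> ty A (plug s h u) = ty A s"
    and q: "q \<in> ty A s" and no_run: "q \<notin> ty A zero_tree"
  shows "\<exists>u\<in>marked. ty A u = ty A s \<and> infinite {\<phi>. run A q u \<phi>}"
proof -
  have H: "antichain H" "zero_off H s" using C \<open>H \<noteq> {}\<close> by (auto simp: ctxt_def)
  have nil: "[] \<notin> H" using ctxt_not_Nil[OF C] by blast
  then have nil_off: "\<not> below H []" by (simp add: below_def)
  obtain \<phi> where \<phi>: "\<And>p. p \<in> ty A s \<Longrightarrow> run A p s (\<phi> p)"
    using bchoice[of "ty A s" "\<lambda>p \<phi>. run A p s \<phi>"] by (auto simp: ty_def)
  have \<phi>H: "\<phi> p h \<in> ty A s" if "p \<in> ty A s" "h \<in> H" for p h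
    using ty_sub[OF \<phi>[OF that(1)], of h] ty_H[OF that(2)] by simp
  let ?N = "nest H \<phi>"
  note N = nest_unfold[OF H(1) nil, of \<phi>]
  have N_off: "?N p v = \<phi> p v" if "\<not> below H v" for p v
    using N[of p] graft_off[OF that, of "\<phi> p"] by metis
  have sub_N: "sub (?N p) h = ?N (\<phi> p h)" if "h \<in> H" for p h
    unfolding N[of p] by (rule sub_graft[OF H(1) that])
  have N_Nil: "?N p [] = p" if "p \<in> ty A s" for p
    using N_off[OF nil_off, of p] \<phi>[OF that] by (simp add: run_def)
  have N_at: "?N p h = \<phi> p h" if "p \<in> ty A s" "h \<in> H" for p h
    using sub_N[OF that(2), of p] N_Nil[OF \<phi>H[OF that]] sub_apply[of "?N p" h "[]"] by simp
  \<comment> \<open>Every node lies outside the holes of the innermost copy of \<open>s\<close>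
    around it, where \<open>s\<close> is labelled 0; so the transitions are those of the chosen
    runs.\<close>
  have N_step: "step A zero_tree (?N p) v" if "p \<in> ty A s" for p v
    using that
  proof (induction "length v" arbitrary: p v rule: less_induct)
    case less
    show ?case
    proof (cases "below H v")
      case True
      then obtain h w where h: "h \<in> H" "v = h @ w" by (rule belowE)
      then have "length w < length v" using nil by auto
      then have "step A zero_tree (?N (\<phi> p h)) w" using less \<phi>H h by blast
      then show ?thesis
        using step_sub[of A zero_tree h "?N p" w] sub_N[OF h(1), of p] h(2) by (simp add: sub_def)
    next
      case False
      have "?N p (v @ [b]) = \<phi> p (v @ [b])" for b
        using N_at[OF less(2), of "v @ [b]"] N_off[of "v @ [b]" p] False by (auto simp: below_snoc)
      moreover have "step A s (\<phi> p) v" using \<phi>[OF less(2)] by (simp add: run_def)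
      moreover have "s v = 0" using H(2) False by (simp add: zero_off_def)
      ultimately show ?thesis using N_off[OF False, of p] by (simp add: step_def)
    qed
  qed
  have "\<not> run A q zero_tree (?N q)" using no_run by (auto simp: ty_def)
  then obtain \<beta> where \<beta>: "\<not> good_branch A (?N q) \<beta>"
    using N_step[OF q] N_Nil[OF q] by (auto simp: run_def)
  \<comment> \<open>A branch avoiding \<open>H\<close> follows the accepting run
    \<open>\<phi> p\<close>. A rejecting branch therefore enters a hole, and its tail is still
    rejecting.\<close>
  have next_hole: "\<exists>h\<in>H. pre \<gamma> (length h) = h \<and> \<not> good_branch A (?N (\<phi> p h)) (\<lambda>i. \<gamma> (length h + i))"
    if p: "p \<in> ty A s" and bad: "\<not> good_branch A (?N p) \<gamma>" for p \<gamma>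
  proof (cases "\<exists>n. below H (pre \<gamma> n)")
    case True
    then obtain h where h: "h \<in> H" "pre \<gamma> (length h) = h" using below_pre by blast
    then show ?thesis
      using bad good_branch_append[of A "?N p" \<gamma> "length h"] sub_N[OF h(1), of p] by auto
  next
    case False
    then have "?N p (pre \<gamma> n) = \<phi> p (pre \<gamma> n)" for n by (simp add: N_off)
    then have "good_branch A (?N p) \<gamma> \<longleftrightarrow> good_branch A (\<phi> p) \<gamma>" by (simp add: good_branch_def)
    then show ?thesis using \<phi>[OF p] bad by (simp add: run_def)
  qed
  \<comment> \<open>\<open>next_hole\<close> is iterated on pairs of the current state and the
    remaining rejecting branch.\<close>
  define ok where "ok x \<longleftrightarrow> fst x \<in> ty A s \<and> \<not> good_branch A (?N (fst x)) (snd x)" for x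
  define hole where "hole x = (SOME h. h \<in> H \<and> pre (snd x) (length h) = h \<and>
    \<not> good_branch A (?N (\<phi> (fst x) h)) (\<lambda>i. snd x (length h + i)))" for x
  define succ where "succ x = (\<phi> (fst x) (hole x), \<lambda>i. snd x (length (hole x) + i))" for x
  have hole: "hole x \<in> H" "pre (snd x) (length (hole x)) = hole x" "ok (succ x)" if "ok x" for x
  proof -
    have "hole x \<in> H \<and> pre (snd x) (length (hole x)) = hole x \<and>
        \<not> good_branch A (?N (\<phi> (fst x) (hole x))) (\<lambda>i. snd x (length (hole x) + i))"
      unfolding hole_def using next_hole[of "fst x" "snd x"] that
      by (intro someI_ex[of "\<lambda>h. h \<in> H \<and> pre (snd x) (length h) = h \<and>
        \<not> good_branch A (?N (\<phi> (fst x) h)) (\<lambda>i. snd x (length h + i))"]) (auto simp: ok_def)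
    then show "hole x \<in> H" "pre (snd x) (length (hole x)) = hole x" "ok (succ x)"
      using \<phi>H that by (auto simp: ok_def succ_def)
  qed
  define x where "x i = (succ ^^ i) (q, \<beta>)" for i
  have x0: "x 0 = (q, \<beta>)" and xS: "x (Suc i) = succ (x i)" for i by (simp_all add: x_def)
  have ok: "ok (x i)" for i
    using q \<beta> hole(3) by (induction i) (auto simp: x0 xS ok_def)
  let ?h = "\<lambda>i. hole (x i)" and ?u = "limit_tree (\<lambda>_. s) (\<lambda>i. hole (x i))"
  have h: "?h i \<in> H" "pre (snd (x i)) (length (?h i)) = ?h i" for i using hole ok by blast+
  have u: "?u i = plug s (?h i) (?u (Suc i))" for i
    using limit_tree_unfold[of ?h i "\<lambda>_. s"] h(1)[of i] nil by metis
  have u_typed: "?u i \<in> typed A Y" for i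
    using typed_limit_tree[OF cl, of "\<lambda>_. s" ?h "\<lambda>_. H"] C h(1) by blast
  have u_ty: "ty A (?u i) = ty A s" for i
    using u[of i] ins[OF h(1) u_typed, of i "Suc i"] by metis
  \<comment> \<open>The induction on \<open>n\<close> needs all \<open>i\<close>: as holes are
    nonempty, agreement up to \<open>n\<close> in the next copy gives agreement up to
    \<open>Suc n\<close> here. For \<open>n = 0\<close> any run will do, and one exists because
    \<open>?u i\<close> has the type of \<open>s\<close>.\<close>
  have approx: "\<exists>\<psi>. run A (fst (x i)) (?u i) \<psi> \<and>
      (\<forall>k\<le>n. \<psi> (pre (snd (x i)) k) = ?N (fst (x i)) (pre (snd (x i)) k))" for n i
  proof (induction n arbitrary: i)
    case 0
    have p: "fst (x i) \<in> ty A s" using ok[of i] by (simp add: ok_def)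
    then obtain \<psi> where "run A (fst (x i)) (?u i) \<psi>" using u_ty[of i] by (auto simp: ty_def)
    then show ?case using N_Nil[OF p] by (auto simp: run_def)
  next
    case (Suc n)
    let ?p = "fst (x i)" and ?\<gamma> = "snd (x i)" and ?l = "length (?h i)"
    have p: "?p \<in> ty A s" using ok[of i] by (simp add: ok_def)
    have p': "fst (x (Suc i)) = \<phi> ?p (?h i)" and \<gamma>': "snd (x (Suc i)) = (\<lambda>j. ?\<gamma> (?l + j))"
      by (simp_all add: xS succ_def)
    obtain \<psi> where \<psi>: "run A (\<phi> ?p (?h i)) (?u (Suc i)) \<psi>"
      and agree: "\<And>k. k \<le> n \<Longrightarrow> \<psi> (pre (snd (x (Suc i))) k) =
        ?N (\<phi> ?p (?h i)) (pre (snd (x (Suc i))) k)"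
      using Suc[of "Suc i"] unfolding p' by blast
    have "run A ?p (?u i) (plug (\<phi> ?p) (?h i) \<psi>)"
      unfolding u[of i] by (rule run_plug[OF \<phi>[OF p] \<psi>])
    moreover have "plug (\<phi> ?p) (?h i) \<psi> (pre ?\<gamma> k) = ?N ?p (pre ?\<gamma> k)" if "k \<le> Suc n" for k
    proof (cases "k < ?l")
      case True
      have "\<not> below H (pre ?\<gamma> k)"
      proof
        assume "below H (pre ?\<gamma> k)"
        then obtain h' where h': "h' \<in> H" "prefix h' (pre ?\<gamma> k)" by (auto simp: below_def)
        have "prefix (pre ?\<gamma> k) (?h i)" using pre_mono[of k ?l ?\<gamma>] h(2)[of i] True by simp
        then have "prefix h' (?h i)" using h'(2) by (rule prefix_order.trans[rotated])
        then have "h' = ?h i" using antichainD[OF H(1) h'(1) h(1)] by blast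
        then show False using prefix_length_le[OF h'(2)] True by simp
      qed
      moreover from this have "\<not> prefix (?h i) (pre ?\<gamma> k)" using h(1)[of i] by (auto simp: below_def)
      ultimately show ?thesis by (simp add: N_off graft_off)
    next
      case False
      define j where "j = k - ?l"
      have k: "k = ?l + j" using False by (simp add: j_def)
      have "?l \<noteq> 0" using h(1)[of i] nil by auto
      then have "j \<le> n" using k that by linarith
      have "pre ?\<gamma> k = ?h i @ pre (snd (x (Suc i))) j"
        unfolding k pre_add h(2) \<gamma>' ..
      moreover have "?N ?p (?h i @ w) = ?N (\<phi> ?p (?h i)) w" for w
        using sub_N[OF h(1), of ?p i] by (metis sub_apply)
      ultimately show ?thesis using agree[OF \<open>j \<le> n\<close>] by (simp add: graft_below)
    qed
    ultimately show ?case by blast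
  qed
  \<comment> \<open>If there were only finitely many runs, one of them would agree with the nested
    computation along all of \<open>\<beta>\<close> and be rejecting.\<close>
  have "infinite {\<psi>. run A q (?u 0) \<psi>}"
  proof
    assume fin: "finite {\<psi>. run A q (?u 0) \<psi>}"
    have "\<forall>n. \<exists>\<psi>. run A q (?u 0) \<psi> \<and> (\<forall>k\<le>n. \<psi> (pre \<beta> k) = ?N q (pre \<beta> k))"
      using approx[of 0] by (simp add: x0)
    then obtain f where f: "\<And>n. run A q (?u 0) (f n)"
      "\<And>n k. k \<le> n \<Longrightarrow> f n (pre \<beta> k) = ?N q (pre \<beta> k)" by metis
    have "finite (range f)" using f(1) by (intro finite_subset[OF _ fin]) auto
    then obtain m where m: "infinite {n. f n = f m}"
      using pigeonhole_infinite[of UNIV f] by auto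
    have "f m (pre \<beta> k) = ?N q (pre \<beta> k)" for k
    proof -
      obtain n where "n \<in> {n. f n = f m}" "k \<le> n"
        using m by (meson infinite_nat_iff_unbounded_le)
      then show ?thesis using f(2)[of k n] by simp
    qed
    then have "good_branch A (?N q) \<beta> \<longleftrightarrow> good_branch A (f m) \<beta>" by (simp add: good_branch_def)
    then show False using f(1)[of m] \<beta> by (simp add: run_def)
  qed
  then show ?thesis using u_typed[of 0] u_ty[of 0] typed_marked by blast
qed

theorem ex_many_runs:
  assumes "wf_pta A"
  shows "\<exists>s\<in>marked. \<forall>q\<in>ty A s. q \<in> ty A zero_tree \<or>
    (\<exists>u\<in>marked. ty A u = ty A s \<and> infinite {\<phi>. run A q u \<phi>})"
proof -
  obtain Y where Y: "minimal_types A Y" using ex_minimal_types[OF assms] by blast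
  obtain s H where s: "s \<in> typed A Y" "H \<noteq> {}"
    and H: "\<forall>h\<in>H. ctxt A Y s h H \<and> ty A (sub s h) = ty A s \<and>
      (\<forall>u\<in>typed A Y. ty A (plug s h u) = ty A s)"
    using ex_insensitive_tree[OF Y] by blast
  have cl: "closed_types A Y" using Y by (simp add: minimal_types_def)
  have "\<exists>u\<in>marked. ty A u = ty A s \<and> infinite {\<phi>. run A q u \<phi>}"
    if "q \<in> ty A s" "q \<notin> ty A zero_tree" for q
    by (rule ex_many_runs_at[OF cl s _ _ _ that]) (use H in blast)+
  then show ?thesis using typed_marked[OF s(1)] by blast
qed

section \<open>Decomposing runs\<close>

lemma run_root:
  assumes "run A q t \<phi>"
  obtains q1 q2 where "(q, t [], q1, q2) \<in> trans A"
    "run A q1 (sub t [False]) (sub \<phi> [False])" "run A q2 (sub t [True]) (sub \<phi> [True])"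
proof
  have "step A t \<phi> []" using assms by (simp add: run_def)
  then show "(q, t [], \<phi> [False], \<phi> [True]) \<in> trans A" using assms by (simp add: run_def step_def)
qed (use run_sub[OF assms] in simp_all)

lemma run_eq_node_tree: "run A q t \<phi> \<Longrightarrow> \<phi> = node_tree q (sub \<phi> [False]) (sub \<phi> [True])"
  by (auto simp: fun_eq_iff node_tree_def run_def sub_apply split: list.splits)

lemma ty_iff:
  "q \<in> ty A t \<longleftrightarrow> (\<exists>q1 q2. (q, t [], q1, q2) \<in> trans A \<and>
     q1 \<in> ty A (sub t [False]) \<and> q2 \<in> ty A (sub t [True]))" (is "_ \<longleftrightarrow> ?R")
proof
  assume "q \<in> ty A t"
  then show ?R unfolding ty_def by (blast elim: run_root)
next
  assume ?R
  then obtain q1 q2 \<psi>1 \<psi>2 where q: "(q, t [], q1, q2) \<in> trans A"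
    and "run A q1 (sub t [False]) \<psi>1" "run A q2 (sub t [True]) \<psi>2" unfolding ty_def by blast
  then have "run A q t (graft {[False], [True]}
      (\<lambda>v. if v = [] then q else if v = [False] then q1 else q2) (\<lambda>v. if v = [False] then \<psi>1 else \<psi>2))"
    using antichain_children
  proof (intro run_graft)
    fix \<beta> assume "\<And>n. \<not> below {[False], [True]} (pre \<beta> n)"
    from this[of 1] have False by (simp add: below_children pre_Suc)
    then show "good_branch A (\<lambda>v. if v = [] then q else if v = [False] then q1 else q2) \<beta>" ..
  qed (auto simp: below_children step_def)
  then show "q \<in> ty A t" by (auto simp: ty_def)
qed

lemma run_const: "even (color A q) \<Longrightarrow> (\<And>v. (q, t v, q, q) \<in> trans A) \<Longrightarrow> run A q t (\<lambda>_. q)"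
  by (auto simp: run_def step_def good_branch_def intro: parity_ok_const)

definition deterministic_on :: "pta \<Rightarrow> nat set \<Rightarrow> bool" where
  "deterministic_on A D \<longleftrightarrow> (\<forall>q\<in>D. \<forall>a q1 q2 q1' q2'. (q, a, q1, q2) \<in> trans A \<longrightarrow>
     (q, a, q1', q2') \<in> trans A \<longrightarrow> q1' = q1 \<and> q2' = q2 \<and> q1 \<in> D \<and> q2 \<in> D)"

lemma deterministic_run_unique:
  assumes D: "deterministic_on A D" and "q \<in> D" and \<phi>: "run A q t \<phi>" and \<psi>: "run A q t \<psi>"
  shows "\<phi> = \<psi>"
proof
  fix v
  have "\<phi> v = \<psi> v \<and> \<phi> v \<in> D"
  proof (induction v rule: rev_induct)
    case Nil
    then show ?case using assms by (simp add: run_def)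
  next
    case (snoc b v)
    have "step A t \<phi> v" "step A t \<psi> v" using \<phi> \<psi> by (auto simp: run_def)
    then show ?case using snoc D unfolding step_def deterministic_on_def by (cases b) metis+
  qed
  then show "\<phi> v = \<psi> v" ..
qed

lemma deterministic_runs_subset:
  assumes "deterministic_on A D" "q \<in> D"
  shows "\<exists>\<psi>. {\<phi>. run A q t \<phi>} \<subseteq> {\<psi>}"
  using deterministic_run_unique[OF assms] by blast

lemma sub_trees: "t \<in> trees \<Sigma> \<Longrightarrow> sub t v \<in> trees \<Sigma>"
  by (simp add: trees_def sub_apply)

lemma graft_trees: "t \<in> trees \<Sigma> \<Longrightarrow> (\<And>h. f h \<in> trees \<Sigma>) \<Longrightarrow> graft H t f \<in> trees \<Sigma>"
  by (simp add: trees_def graft_def Let_def)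

lemma marked_trees: "t \<in> marked \<Longrightarrow> {0, 1} \<subseteq> \<Sigma> \<Longrightarrow> t \<in> trees \<Sigma>"
  unfolding marked_def trees_def by blast

lemma zero_tree_trees: "0 \<in> \<Sigma> \<Longrightarrow> zero_tree \<in> trees \<Sigma>"
  by (simp add: trees_def)

section \<open>Incomparable positions hanging off the leftmost branch\<close>

definition hang :: "nat \<Rightarrow> node" where
  "hang i = replicate i False @ [True]"

lemma hang_0: "hang 0 = [True]"
  by (simp add: hang_def)

lemma hang_Suc: "hang (Suc i) = [False] @ hang i"
  by (simp add: hang_def)

lemma prefix_hang: "prefix (hang i) (hang j) \<longleftrightarrow> i = j"
proof (induction i arbitrary: j)
  case 0
  then show ?case by (cases j) (simp_all add: hang_0 hang_Suc)
next
  case (Suc i)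
  then show ?case by (cases j) (simp_all add: hang_0 hang_Suc)
qed

lemma inj_hang: "inj hang"
  by (metis injI prefix_hang prefix_order.refl)

lemma antichain_hang: "antichain (hang ` I)"
  by (auto simp: antichain_def prefix_hang)

lemma below_hang: "below (range hang) v \<longleftrightarrow> True \<in> set v"
proof
  assume "below (range hang) v"
  then show "True \<in> set v" by (auto simp: below_def prefix_def hang_def)
next
  assume "True \<in> set v"
  then obtain ys zs where v: "v = ys @ True # zs" "True \<notin> set ys" using split_list_first by metis
  then have "ys = replicate (length ys) False" by (metis (full_types) replicate_eqI)
  then have "v = hang (length ys) @ zs" using v(1) by (simp add: hang_def)
  then show "below (range hang) v" using belowI by blast
qed

section \<open>Lower bounds on the ambiguity\<close>

text \<open>The accepting run on the tree with the zero tree at v i and s at all other v j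
  can be changed into one on the tree with the zero tree everywhere. Two of these runs cannot
  agree at all v j, as otherwise one could put s everywhere.\<close>

lemma ambiguity_lower_bound:
  assumes A: "wf_pta A" and \<Sigma>: "{0, 1} \<subseteq> alph A"
    and fin: "\<And>t. t \<in> trees (alph A) \<Longrightarrow> finite (ACC A t)"
    and inj: "inj_on v {..<n}" and anti: "antichain (v ` {..<n})"
    and b: "b \<in> trees (alph A)"
    and yes: "\<And>s i. s \<in> marked \<Longrightarrow> i < n \<Longrightarrow>
      graft (v ` {..<n}) b (\<lambda>h. if h = v i then zero_tree else s) \<in> lang A"
    and no: "\<And>s. s \<in> marked \<Longrightarrow> graft (v ` {..<n}) b (\<lambda>_. s) \<notin> lang A"
  shows "\<exists>t\<in>trees (alph A). n \<le> card (ACC A t)"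
proof -
  let ?H = "v ` {..<n}"
  obtain s where s: "s \<in> marked" and many: "\<And>q. q \<in> ty A s \<Longrightarrow> q \<notin> ty A zero_tree \<Longrightarrow>
      \<exists>u\<in>marked. infinite {\<phi>. run A q u \<phi>}"
    using ex_many_runs[OF A] by metis
  define T where "T i = graft ?H b (\<lambda>h. if h = v i then zero_tree else s)" for i
  have zero: "zero_tree \<in> trees (alph A)" using \<Sigma> by (intro zero_tree_trees) auto
  have T: "T i \<in> trees (alph A)" for i
    unfolding T_def using b zero marked_trees[OF s \<Sigma>] by (intro graft_trees) auto
  have "\<forall>i. \<exists>\<phi>. i < n \<longrightarrow> \<phi> [] \<in> init A \<and> run A (\<phi> []) (T i) \<phi>"
    using yes[OF s] unfolding T_def lang_def ACC_def by (auto simp: accepting_iff_run)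
  then obtain \<phi> where \<phi>: "\<And>i. i < n \<Longrightarrow> \<phi> i [] \<in> init A"
    "\<And>i. i < n \<Longrightarrow> run A (\<phi> i []) (T i) (\<phi> i)" by metis
  have sub_T: "sub (T i) h = (if h = v i then zero_tree else s)" if "h \<in> ?H" for i h
    unfolding T_def using sub_graft[OF anti that, of b] by simp
  have \<phi>_s: "\<phi> i h \<in> ty A s" if "i < n" "h \<in> ?H" "h \<noteq> v i" for i h
    using ty_sub[OF \<phi>(2)[OF that(1)], of h] sub_T[OF that(2)] that(3) by simp
  have \<phi>_zero: "\<phi> i h \<in> ty A zero_tree" if i: "i < n" and h: "h \<in> ?H" for i h
  proof (cases "h = v i")
    case True
    then show ?thesis using ty_sub[OF \<phi>(2)[OF i], of h] sub_T[OF h] by simp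
  next
    case False
    show ?thesis
    proof (rule ccontr)
      \<comment> \<open>A tree with infinitely many runs from this state could be plugged in at
        \<open>h\<close>, giving infinitely many accepting runs of \<open>A\<close> on one
        tree.\<close>
      assume "\<phi> i h \<notin> ty A zero_tree"
      then obtain u where u: "u \<in> marked" and inf: "infinite {\<psi>. run A (\<phi> i h) u \<psi>}"
        using many[OF \<phi>_s[OF i h False]] by blast
      have "inj_on (plug (\<phi> i) h) {\<psi>. run A (\<phi> i h) u \<psi>}"
        by (rule inj_on_inverseI[of _ "\<lambda>t. sub t h"]) simp
      then have "infinite (plug (\<phi> i) h ` {\<psi>. run A (\<phi> i h) u \<psi>})"
        using inf by (simp add: finite_image_iff)
      moreover have "plug (\<phi> i) h ` {\<psi>. run A (\<phi> i h) u \<psi>} \<subseteq> ACC A (plug (T i) h u)"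
        using run_plug[OF \<phi>(2)[OF i]] \<phi>(1)[OF i] by (auto simp: ACC_eq)
      moreover have "plug (T i) h u \<in> trees (alph A)"
        using T marked_trees[OF u \<Sigma>] by (rule graft_trees)
      ultimately show False using fin[of "plug (T i) h u"] finite_subset by blast
    qed
  qed
  obtain \<zeta> where \<zeta>: "\<And>q. q \<in> ty A zero_tree \<Longrightarrow> run A q zero_tree (\<zeta> q)"
    using bchoice[of "ty A zero_tree" "\<lambda>q \<phi>. run A q zero_tree \<phi>"] by (auto simp: ty_def)
  let ?t = "graft ?H b (\<lambda>_. zero_tree)"
  define \<psi> where "\<psi> i = graft ?H (\<phi> i) (\<lambda>h. \<zeta> (\<phi> i h))" for i
  have \<psi>: "run A (\<phi> i []) ?t (\<psi> i)" if "i < n" for i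
    unfolding \<psi>_def
    by (rule run_graft_run[OF anti \<phi>(2)[OF that]])
      (use \<zeta> \<phi>_zero[OF that] in \<open>simp_all add: graft_off T_def sub_graft[OF anti]\<close>)
  have \<psi>_at: "\<psi> i h = \<phi> i h" if "i < n" "h \<in> ?H" for i h
    using graft_at[OF anti that(2)] \<zeta>[OF \<phi>_zero[OF that]] unfolding \<psi>_def run_def by metis
  have "inj_on \<psi> {..<n}"
  proof (rule inj_onI, rule ccontr)
    fix i j assume ij: "i \<in> {..<n}" "j \<in> {..<n}" "\<psi> i = \<psi> j" "i \<noteq> j"
    \<comment> \<open>The only doubtful position is \<open>v i\<close>, where \<open>T i\<close> has
      the zero tree. There the state equals that of \<open>\<phi> j\<close>, and \<open>T j\<close>
      carries \<open>s\<close> at \<open>v i\<close>.\<close>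
    have "\<phi> i h \<in> ty A s" if h: "h \<in> ?H" for h
    proof (cases "h = v i")
      case True
      then have "h \<noteq> v j" using inj ij by (metis inj_onD)
      then have "\<phi> j h \<in> ty A s" using \<phi>_s ij h by blast
      then show ?thesis using \<psi>_at[of i h] \<psi>_at[of j h] ij h by simp
    qed (use \<phi>_s ij h in blast)
    then have "\<forall>h\<in>?H. \<exists>\<xi>. run A (\<phi> i h) s \<xi>" by (simp add: ty_def)
    then obtain \<xi> where \<xi>: "\<And>h. h \<in> ?H \<Longrightarrow> run A (\<phi> i h) s (\<xi> h)" by metis
    have "run A (\<phi> i []) (graft ?H b (\<lambda>_. s)) (graft ?H (\<phi> i) \<xi>)"
      by (rule run_graft_run[OF anti \<phi>(2)])
        (use ij \<xi> in \<open>simp_all add: graft_off T_def sub_graft[OF anti]\<close>)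
    moreover have "graft ?H b (\<lambda>_. s) \<in> trees (alph A)"
      using b marked_trees[OF s \<Sigma>] by (rule graft_trees)
    ultimately have "graft ?H b (\<lambda>_. s) \<in> lang A"
      using \<phi>(1) ij unfolding lang_eq ty_def by blast
    then show False using no[OF s] by blast
  qed
  then have "n = card (\<psi> ` {..<n})" by (simp add: card_image)
  also have t: "?t \<in> trees (alph A)" using b zero by (rule graft_trees)
  then have "card (\<psi> ` {..<n}) \<le> card (ACC A ?t)"
    using \<psi> \<phi>(1) fin by (intro card_mono) (auto simp: ACC_eq)
  finally show ?thesis using t by blast
qed

section \<open>A zero subtree at one of k positions\<close>

text \<open>State 0 accepts everything, state 1 the zero tree. State 2 + j at the node l^j means that
  the zero subtree has not been announced yet.\<close>

definition bounded_aut :: "nat \<Rightarrow> pta" where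
  "bounded_aut k = \<lparr>states = {..<k + 2}, alph = {0, 1}, init = {2},
     trans = {(0, 0, 0, 0), (0, 1, 0, 0), (1, 0, 1, 1)} \<union>
       {(2 + j, a, 2 + Suc j, 0) |j a. Suc j < k \<and> a \<in> {0, 1}} \<union>
       {(2 + j, a, 0, 1) |j a. j < k \<and> a \<in> {0, 1}},
     color = (\<lambda>_. 0)\<rparr>"

lemma bounded_aut_simps [simp]:
  "alph (bounded_aut k) = {0, 1}" "init (bounded_aut k) = {2}" "color (bounded_aut k) q = 0"
  by (simp_all add: bounded_aut_def)

lemma wf_bounded_aut: "0 < k \<Longrightarrow> wf_pta (bounded_aut k)"
  by (auto simp: wf_pta_def bounded_aut_def)

lemma bounded_aut_any: "t \<in> trees {0, 1} \<Longrightarrow> 0 \<in> ty (bounded_aut k) t"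
  using run_const[of "bounded_aut k" 0 t] by (auto simp: bounded_aut_def ty_def trees_def)

lemma deterministic_bounded_aut: "deterministic_on (bounded_aut k) {0, 1}"
  by (auto simp: deterministic_on_def bounded_aut_def)

lemma ty_zero_state:
  assumes "\<And>a q1 q2. (q, a, q1, q2) \<in> trans A \<longleftrightarrow> a = 0 \<and> q1 = q \<and> q2 = q" and "even (color A q)"
  shows "q \<in> ty A t \<longleftrightarrow> t = zero_tree"
proof
  assume "q \<in> ty A t"
  then obtain \<phi> where \<phi>: "run A q t \<phi>" by (auto simp: ty_def)
  have "\<phi> v = q \<and> t v = 0" for v
  proof (induction v rule: rev_induct)
    case Nil
    have "step A t \<phi> []" using \<phi> by (simp add: run_def)
    then show ?case using \<phi> by (simp add: run_def step_def assms(1))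
  next
    case (snoc b v)
    have "step A t \<phi> v" "step A t \<phi> (v @ [b])" using \<phi> by (simp_all add: run_def)
    then show ?case using snoc by (cases b) (simp_all add: step_def assms(1))
  qed
  then show "t = zero_tree" by auto
next
  assume "t = zero_tree"
  then show "q \<in> ty A t" using run_const[of A q t] assms by (auto simp: ty_def)
qed

lemma bounded_aut_zero: "Suc 0 \<in> ty (bounded_aut k) t \<longleftrightarrow> t = zero_tree"
  by (rule ty_zero_state) (auto simp: bounded_aut_def)

lemma bounded_aut_trans:
  "(2 + j, a, q1, q2) \<in> trans (bounded_aut k) \<longleftrightarrow> a \<in> {0, 1} \<and>
     (Suc j < k \<and> q1 = 2 + Suc j \<and> q2 = 0 \<or> j < k \<and> q1 = 0 \<and> q2 = 1)"
  by (auto simp: bounded_aut_def)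

lemma bounded_aut_ty:
  "2 + j \<in> ty (bounded_aut k) t \<longleftrightarrow> t [] \<in> {0, 1} \<and>
     (Suc j < k \<and> 2 + Suc j \<in> ty (bounded_aut k) (sub t [False]) \<and> 0 \<in> ty (bounded_aut k) (sub t [True]) \<or>
      j < k \<and> 0 \<in> ty (bounded_aut k) (sub t [False]) \<and> sub t [True] = zero_tree)"
  using bounded_aut_zero[of k "sub t [True]"]
  by (subst ty_iff, unfold bounded_aut_trans One_nat_def) blast

lemma bounded_aut_pending:
  assumes "t \<in> trees {0, 1}" "m + j = k"
  shows "2 + j \<in> ty (bounded_aut k) t \<longleftrightarrow> (\<exists>i<m. sub t (hang i) = zero_tree)"
  using assms
proof (induction m arbitrary: j t)
  case 0
  then show ?case by (subst bounded_aut_ty) simp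
next
  case (Suc m)
  have t: "t [] \<in> {0, 1}" "sub t v \<in> trees {0, 1}" for v
    using Suc(2) sub_trees by (simp_all add: trees_def sub_apply)
  have "2 + j \<in> ty (bounded_aut k) t \<longleftrightarrow>
      (Suc j < k \<and> 2 + Suc j \<in> ty (bounded_aut k) (sub t [False])) \<or> sub t [True] = zero_tree"
    using Suc(3) t(1) bounded_aut_any[OF t(2)] by (subst bounded_aut_ty) auto
  also have "Suc j < k \<and> 2 + Suc j \<in> ty (bounded_aut k) (sub t [False]) \<longleftrightarrow>
      (\<exists>i<m. sub t (hang (Suc i)) = zero_tree)"
    using Suc(1)[OF t(2), of "Suc j" "[False]"] Suc(3) by (cases "Suc j < k") (auto simp: hang_Suc)
  finally show ?case by (auto simp: less_Suc_eq_0_disj hang_0)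
qed

lemma lang_bounded_aut:
  "lang (bounded_aut k) = {t \<in> trees {0, 1}. \<exists>i<k. sub t (hang i) = zero_tree}"
  using bounded_aut_pending[of _ k 0 k] by (auto simp: lang_eq)

text \<open>The announced position, one of the \<open>m\<close> remaining ones, determines the run:
  after the announcement and in the side subtrees only the deterministic states 0 and 1
  occur.\<close>

lemma bounded_aut_runs:
  assumes "m + j = k"
  shows "finite {\<phi>. run (bounded_aut k) (2 + j) t \<phi>} \<and> card {\<phi>. run (bounded_aut k) (2 + j) t \<phi>} \<le> m"
  using assms
proof (induction m arbitrary: j t)
  case 0
  have "\<not> run (bounded_aut k) (2 + j) t \<phi>" for \<phi>
  proof
    assume "run (bounded_aut k) (2 + j) t \<phi>"
    then obtain q1 q2 where "(2 + j, t [], q1, q2) \<in> trans (bounded_aut k)" by (rule run_root)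
    then show False using 0 unfolding bounded_aut_trans by simp
  qed
  then show ?case by simp
next
  case (Suc m)
  let ?R = "\<lambda>q t. {\<phi>. run (bounded_aut k) q t \<phi>}"
  obtain \<psi>0 \<psi>1 \<psi>2 where \<psi>: "?R 0 (sub t [True]) \<subseteq> {\<psi>0}" "?R 0 (sub t [False]) \<subseteq> {\<psi>1}"
    "?R 1 (sub t [True]) \<subseteq> {\<psi>2}"
    using deterministic_runs_subset[OF deterministic_bounded_aut] by (meson insertI1 insertI2)
  let ?S = "if Suc j < k then ?R (2 + Suc j) (sub t [False]) else {}"
  have S: "finite ?S \<and> card ?S \<le> m"
    using Suc(1)[of "Suc j"] Suc(2) by simp
  let ?X = "(\<lambda>\<phi>. node_tree (2 + j) \<phi> \<psi>0) ` ?S \<union> {node_tree (2 + j) \<psi>1 \<psi>2}"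
  have sub: "?R (2 + j) t \<subseteq> ?X"
  proof (rule subsetI, drule CollectD)
    fix \<phi> assume \<phi>: "run (bounded_aut k) (2 + j) t \<phi>"
    then obtain q1 q2 where q: "(2 + j, t [], q1, q2) \<in> trans (bounded_aut k)"
      "sub \<phi> [False] \<in> ?R q1 (sub t [False])" "sub \<phi> [True] \<in> ?R q2 (sub t [True])"
      by (auto elim: run_root)
    from q(1) consider "Suc j < k" "q1 = 2 + Suc j" "q2 = 0" | "q1 = 0" "q2 = 1"
      unfolding bounded_aut_trans by blast
    then show "\<phi> \<in> (\<lambda>\<phi>. node_tree (2 + j) \<phi> \<psi>0) ` ?S \<union> {node_tree (2 + j) \<psi>1 \<psi>2}"
    proof cases
      case 1
      then have "sub \<phi> [False] \<in> ?S" "sub \<phi> [True] = \<psi>0" using q \<psi> by auto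
      then show ?thesis using run_eq_node_tree[OF \<phi>] by blast
    next
      case 2
      then have "sub \<phi> [False] = \<psi>1" "sub \<phi> [True] = \<psi>2" using q \<psi> by auto
      then show ?thesis using run_eq_node_tree[OF \<phi>] by blast
    qed
  qed
  have "card ?X \<le> m + 1"
    using S card_image_le[of ?S "\<lambda>\<phi>. node_tree (2 + j) \<phi> \<psi>0"]
    by (intro order.trans[OF card_Un_le]) simp
  moreover have fin: "finite ?X" using S by simp
  ultimately show ?case using card_mono[OF fin sub] finite_subset[OF sub] by simp
qed

lemma ACC_bounded_aut: "ACC (bounded_aut k) t = {\<phi>. run (bounded_aut k) 2 t \<phi>}"
  by (simp add: ACC_eq)

lemma bounded_aut_ambiguous:
  assumes "0 < k"
  shows "k_ambiguous_lang k {0, 1} (lang (bounded_aut k))"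
  using bounded_aut_runs[of k 0 k] wf_bounded_aut[OF assms]
  unfolding k_ambiguous_lang_def ACC_bounded_aut
  by (intro exI[of _ "bounded_aut k"]) (simp add: ACC_bounded_aut)

lemma bounded_aut_not_less_ambiguous:
  assumes "k > 1"
  shows "\<not> k_ambiguous_lang (k - 1) {0, 1} (lang (bounded_aut k))"
proof
  assume "k_ambiguous_lang (k - 1) {0, 1} (lang (bounded_aut k))"
  then obtain A where A: "wf_pta A" "alph A = {0, 1}" "lang A = lang (bounded_aut k)"
    "\<And>t. t \<in> trees {0, 1} \<Longrightarrow> finite (ACC A t)" "\<And>t. t \<in> trees {0, 1} \<Longrightarrow> card (ACC A t) \<le> k - 1"
    unfolding k_ambiguous_lang_def by blast
  have hang: "sub (graft (hang ` {..<k}) zero_tree f) (hang i) = f (hang i)" if "i < k" for f i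
    using that by (intro sub_graft antichain_hang) simp
  have "\<exists>t\<in>trees (alph A). k \<le> card (ACC A t)"
  proof (rule ambiguity_lower_bound[of A hang k zero_tree])
    fix s assume s: "s \<in> marked"
    then have "s \<noteq> zero_tree" by (simp add: marked_def)
    then show "graft (hang ` {..<k}) zero_tree (\<lambda>_. s) \<notin> lang A"
      unfolding A(3) lang_bounded_aut using hang by auto
    fix i assume "i < k"
    moreover have "graft (hang ` {..<k}) zero_tree (\<lambda>h. if h = hang i then zero_tree else s) \<in> trees {0, 1}"
      using marked_trees[OF s] zero_tree_trees[of "{0, 1}"] by (intro graft_trees) auto
    ultimately show "graft (hang ` {..<k}) zero_tree (\<lambda>h. if h = hang i then zero_tree else s) \<in> lang A"
      unfolding A(3) lang_bounded_aut using hang by auto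
  qed (use A inj_on_subset[OF inj_hang] antichain_hang zero_tree_trees[of "{0, 1}"] in simp_all)
  then show False using A(2,5) assms by fastforce
qed

section \<open>A zero subtree at one of finitely many positions\<close>

text \<open>The label 2 marks an initial segment of the leftmost branch. States 0 and 1 are as above,
  state 2 announces a zero subtree later, and state 3 checks that the segment is finite.\<close>

definition finite_aut :: pta where
  "finite_aut = \<lparr>states = {0, 1, 2, 3}, alph = {0, 1, 2}, init = {2},
     trans = {(0, 0, 0, 0), (0, 1, 0, 0), (0, 2, 0, 0), (1, 0, 1, 1), (2, 2, 2, 0), (2, 2, 3, 1),
       (3, 2, 3, 0), (3, 0, 0, 0), (3, 1, 0, 0)},
     color = (\<lambda>q. if q = 2 \<or> q = 3 then 1 else 0)\<rparr>"

primrec segment :: "tree \<Rightarrow> nat \<Rightarrow> bool" where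
  "segment t 0 \<longleftrightarrow> t [] \<noteq> 2"
| "segment t (Suc n) \<longleftrightarrow> t [] = 2 \<and> segment (sub t [False]) n"

lemma segment_iff: "segment t n \<longleftrightarrow> (\<forall>j<n. t (replicate j False) = 2) \<and> t (replicate n False) \<noteq> 2"
  by (induction n arbitrary: t) (auto simp: sub_apply less_Suc_eq_0_disj)

lemma finite_aut_simps [simp]:
  "alph finite_aut = {0, 1, 2}" "init finite_aut = {2}"
  "color finite_aut q = (if q = 2 \<or> q = 3 then 1 else 0)"
  by (simp_all add: finite_aut_def)

lemma wf_finite_aut: "wf_pta finite_aut"
  by (auto simp: wf_pta_def finite_aut_def)

lemma finite_aut_any: "t \<in> trees {0, 1, 2} \<Longrightarrow> 0 \<in> ty finite_aut t"
  using run_const[of finite_aut 0 t] by (auto simp: finite_aut_def ty_def trees_def)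

lemma deterministic_finite_aut: "deterministic_on finite_aut {0, 1, 3}"
  by (auto simp: deterministic_on_def finite_aut_def)

lemma finite_aut_zero: "Suc 0 \<in> ty finite_aut t \<longleftrightarrow> t = zero_tree"
  by (rule ty_zero_state) (auto simp: finite_aut_def)

lemma finite_aut_trans:
  "(2, a, q1, q2) \<in> trans finite_aut \<longleftrightarrow> a = 2 \<and> (q1 = 2 \<and> q2 = 0 \<or> q1 = 3 \<and> q2 = 1)"
  "(3, a, q1, q2) \<in> trans finite_aut \<longleftrightarrow> a = 2 \<and> q1 = 3 \<and> q2 = 0 \<or> (a = 0 \<or> a = 1) \<and> q1 = 0 \<and> q2 = 0"
  by (auto simp: finite_aut_def)

lemma finite_aut_ty:
  "2 \<in> ty finite_aut t \<longleftrightarrow> t [] = 2 \<and> (2 \<in> ty finite_aut (sub t [False]) \<and> 0 \<in> ty finite_aut (sub t [True]) \<or>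
     3 \<in> ty finite_aut (sub t [False]) \<and> sub t [True] = zero_tree)"
  using finite_aut_zero[of "sub t [True]"]
  by (subst ty_iff, unfold finite_aut_trans One_nat_def) blast

text \<open>Without an end of the segment, states 2 and 3 would occupy the whole leftmost branch,
  and their common colour 1 rejects it.\<close>

lemma finite_aut_segment:
  assumes \<phi>: "run finite_aut q t \<phi>" and q: "q = 2 \<or> q = 3"
  shows "\<exists>n. segment t n"
proof (rule ccontr)
  assume none: "\<nexists>n. segment t n"
  let ?l = "\<lambda>n. pre (\<lambda>_. False) n"
  have *: "(\<phi> (?l n) = 2 \<or> \<phi> (?l n) = 3) \<and> (\<forall>m. \<not> segment (sub t (?l n)) m)" for n
  proof (induction n)
    case 0
    then show ?case using \<phi> q none by (simp add: run_def)
  next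
    case (Suc n)
    have "t (?l n) = 2" using Suc segment.simps(1)[of "sub t (?l n)"] by (metis append_Nil2 sub_apply)
    moreover have "step finite_aut t \<phi> (?l n)" using \<phi> by (simp add: run_def)
    ultimately have "\<phi> (?l (Suc n)) = 2 \<or> \<phi> (?l (Suc n)) = 3"
      using Suc unfolding step_def pre_Suc by (auto simp: finite_aut_trans)
    moreover have "\<not> segment (sub t (?l (Suc n))) m" for m
    proof
      assume "segment (sub t (?l (Suc n))) m"
      then have "segment (sub t (?l n)) (Suc m)"
        using \<open>t (?l n) = 2\<close> by (simp add: pre_Suc sub_apply)
      then show False using Suc by blast
    qed
    ultimately show ?case by blast
  qed
  have "good_branch finite_aut \<phi> (\<lambda>_. False)" using \<phi> by (simp add: run_def)
  moreover have "color finite_aut (\<phi> (?l n)) = 1" for n using *[of n] by auto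
  ultimately show False unfolding good_branch_def using not_parity_ok_const[of 1] by simp
qed

lemma finite_aut_check:
  assumes "t \<in> trees {0, 1, 2}" "segment t n"
  shows "3 \<in> ty finite_aut t"
  using assms
proof (induction n arbitrary: t)
  case 0
  then have "t [] = 0 \<or> t [] = 1" by (auto simp: trees_def)
  then show ?case
    using finite_aut_any[OF sub_trees[OF 0(1)]] by (subst ty_iff) (auto simp: finite_aut_trans)
next
  case (Suc n)
  then show ?case
    using finite_aut_any[OF sub_trees[OF Suc(2)]] sub_trees[OF Suc(2)]
    by (subst ty_iff) (auto simp: finite_aut_trans)
qed

lemma finite_aut_pending:
  assumes "t \<in> trees {0, 1, 2}" "segment t n"
  shows "2 \<in> ty finite_aut t \<longleftrightarrow> (\<exists>i<n. sub t (hang i) = zero_tree)"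
  using assms
proof (induction n arbitrary: t)
  case 0
  then show ?case by (subst finite_aut_ty) simp
next
  case (Suc n)
  have t: "sub t v \<in> trees {0, 1, 2}" for v using Suc(2) by (rule sub_trees)
  have "2 \<in> ty finite_aut t \<longleftrightarrow> 2 \<in> ty finite_aut (sub t [False]) \<or> sub t [True] = zero_tree"
    using Suc(3) finite_aut_any[OF t] finite_aut_check[OF t, of "[False]" n]
    by (subst finite_aut_ty) auto
  also have "2 \<in> ty finite_aut (sub t [False]) \<longleftrightarrow> (\<exists>i<n. sub t (hang (Suc i)) = zero_tree)"
    using Suc(1)[OF t, of "[False]"] Suc(3) by (simp add: hang_Suc)
  finally show ?case by (auto simp: less_Suc_eq_0_disj hang_0)
qed

text \<open>A tree with a run has a finite segment, and the place of the announcement within it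
  determines the run. On infinite segments there could be infinitely many such places.\<close>

lemma finite_aut_finite_runs: "finite {\<phi>. run finite_aut 2 t \<phi>}"
proof (cases "\<exists>n. segment t n")
  case False
  then have "{\<phi>. run finite_aut 2 t \<phi>} = {}" using finite_aut_segment by blast
  then show ?thesis by simp
next
  case True
  then obtain n where "segment t n" by blast
  then show ?thesis
  proof (induction n arbitrary: t)
    case 0
    have "\<not> run finite_aut 2 t \<phi>" for \<phi>
    proof
      assume "run finite_aut 2 t \<phi>"
      then obtain q1 q2 where "(2, t [], q1, q2) \<in> trans finite_aut" by (rule run_root)
      then show False using 0 by (simp add: finite_aut_trans)
    qed
    then show ?case by simp
  next
    case (Suc n)
    let ?R = "\<lambda>q t. {\<phi>. run finite_aut q t \<phi>}"
    obtain \<psi>0 \<psi>1 \<psi>2 where \<psi>: "?R 0 (sub t [True]) \<subseteq> {\<psi>0}" "?R 3 (sub t [False]) \<subseteq> {\<psi>1}"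
      "?R 1 (sub t [True]) \<subseteq> {\<psi>2}"
      using deterministic_runs_subset[OF deterministic_finite_aut] by (meson insertI1 insertI2)
    have "?R 2 t \<subseteq> (\<lambda>\<phi>. node_tree 2 \<phi> \<psi>0) ` ?R 2 (sub t [False]) \<union> {node_tree 2 \<psi>1 \<psi>2}"
    proof (rule subsetI, drule CollectD)
      fix \<phi> assume \<phi>: "run finite_aut 2 t \<phi>"
      then obtain q1 q2 where q: "(2, t [], q1, q2) \<in> trans finite_aut"
        "sub \<phi> [False] \<in> ?R q1 (sub t [False])" "sub \<phi> [True] \<in> ?R q2 (sub t [True])"
        by (auto elim: run_root)
      from q(1) consider "q1 = 2" "q2 = 0" | "q1 = 3" "q2 = 1" unfolding finite_aut_trans by blast
      then show "\<phi> \<in> (\<lambda>\<phi>. node_tree 2 \<phi> \<psi>0) ` ?R 2 (sub t [False]) \<union> {node_tree 2 \<psi>1 \<psi>2}"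
      proof cases
        case 1
        then have "sub \<phi> [False] \<in> ?R 2 (sub t [False])" "sub \<phi> [True] = \<psi>0" using q \<psi> by auto
        then show ?thesis using run_eq_node_tree[OF \<phi>] by blast
      next
        case 2
        then have "sub \<phi> [False] = \<psi>1" "sub \<phi> [True] = \<psi>2" using q \<psi> by auto
        then show ?thesis using run_eq_node_tree[OF \<phi>] by blast
      qed
    qed
    then show ?case using Suc by (auto intro: finite_subset)
  qed
qed

lemma ACC_finite_aut: "ACC finite_aut t = {\<phi>. run finite_aut 2 t \<phi>}"
  by (simp add: ACC_eq)

lemma lang_finite_aut: "lang finite_aut = {t \<in> trees {0, 1, 2}. 2 \<in> ty finite_aut t}"
  by (simp add: lang_eq)

lemma finite_aut_finitely_ambiguous: "finitely_ambiguous_lang {0, 1, 2} (lang finite_aut)"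
  unfolding finitely_ambiguous_lang_def
  by (intro exI[of _ finite_aut])
    (simp add: wf_finite_aut ACC_finite_aut finite_aut_finite_runs)

lemma finite_aut_not_boundedly_ambiguous: "\<not> boundedly_ambiguous_lang {0, 1, 2} (lang finite_aut)"
proof
  assume "boundedly_ambiguous_lang {0, 1, 2} (lang finite_aut)"
  then obtain k A where A: "wf_pta A" "alph A = {0, 1, 2}" "lang A = lang finite_aut"
    "\<And>t. t \<in> trees {0, 1, 2} \<Longrightarrow> finite (ACC A t)" "\<And>t. t \<in> trees {0, 1, 2} \<Longrightarrow> card (ACC A t) \<le> k"
    unfolding boundedly_ambiguous_lang_def k_ambiguous_lang_def by blast
  \<comment> \<open>The segment length is a matter of the tree and not of the automaton, so a single
    language provides \<open>n\<close> positions for every \<open>n\<close>.\<close>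
  define n where "n = Suc k"
  define b :: tree where "b v = (if \<exists>j<n. v = replicate j False then 2 else 0)" for v
  have b: "b \<in> trees {0, 1, 2}" by (simp add: b_def trees_def)
  let ?T = "graft (hang ` {..<n}) b"
  have hang: "sub (?T f) (hang i) = f (hang i)" if "i < n" for f i
    using that by (intro sub_graft antichain_hang) simp
  have seg: "segment (?T f) n" for f
  proof -
    have "\<not> below (hang ` {..<n}) (replicate j False)" for j
      using below_hang[of "replicate j False"] by (auto simp: below_def)
    then have "?T f (replicate j False) = b (replicate j False)" for j by (rule graft_off)
    moreover have "b (replicate j False) = (if j < n then 2 else 0)" for j
      unfolding b_def replicate_eq_replicate by auto
    ultimately show ?thesis unfolding segment_iff by simp
  qed
  have lang: "?T f \<in> lang A \<longleftrightarrow> (\<exists>i<n. f (hang i) = zero_tree)"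
    if "\<And>h. f h \<in> trees {0, 1, 2}" for f
    unfolding A(3) lang_finite_aut
    using graft_trees[OF b that] finite_aut_pending[OF graft_trees[OF b that] seg] hang by auto
  have zero: "zero_tree \<in> trees {0, 1, 2}" by (rule zero_tree_trees) simp
  have "\<exists>t\<in>trees (alph A). n \<le> card (ACC A t)"
  proof (rule ambiguity_lower_bound[of A hang n b])
    fix s assume s: "s \<in> marked"
    then have "s \<noteq> zero_tree" by (simp add: marked_def)
    moreover have s': "s \<in> trees {0, 1, 2}" using marked_trees[OF s, of "{0, 1, 2}"] by simp
    ultimately show "?T (\<lambda>_. s) \<notin> lang A" using lang by simp
    fix i assume "i < n"
    then show "?T (\<lambda>h. if h = hang i then zero_tree else s) \<in> lang A"
      using zero s' by (subst lang) auto
  qed (use A inj_on_subset[OF inj_hang] antichain_hang b in simp_all)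
  then show False using A(2,5) unfolding n_def by fastforce
qed

section \<open>Searching for a nonzero label\<close>

text \<open>State 0 accepts everything, state 1 searches for the label 1, and state 2
  starts such a search to the right of every node of the leftmost branch.\<close>

definition search_aut :: "nat \<Rightarrow> pta" where
  "search_aut q0 = \<lparr>states = {0, 1, 2}, alph = {0, 1}, init = {q0},
     trans = {(0, 0, 0, 0), (0, 1, 0, 0), (1, 0, 1, 0), (1, 0, 0, 1), (1, 1, 0, 0),
       (2, 0, 2, 1), (2, 1, 2, 1)},
     color = (\<lambda>q. if q = 1 then 1 else 0)\<rparr>"

lemma search_aut_simps [simp]:
  "alph (search_aut q0) = {0, 1}" "init (search_aut q0) = {q0}"
  "color (search_aut q0) q = (if q = 1 then 1 else 0)"
  by (simp_all add: search_aut_def)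

lemma wf_search_aut: "q0 \<in> {0, 1, 2} \<Longrightarrow> wf_pta (search_aut q0)"
  by (auto simp: wf_pta_def search_aut_def)

lemma search_aut_trans:
  "(0, a, q1, q2) \<in> trans (search_aut q0) \<longleftrightarrow> (a = 0 \<or> a = 1) \<and> q1 = 0 \<and> q2 = 0"
  "(Suc 0, a, q1, q2) \<in> trans (search_aut q0) \<longleftrightarrow>
     a = 0 \<and> (q1 = 1 \<and> q2 = 0 \<or> q1 = 0 \<and> q2 = 1) \<or> a = 1 \<and> q1 = 0 \<and> q2 = 0"
  "(2, a, q1, q2) \<in> trans (search_aut q0) \<longleftrightarrow> (a = 0 \<or> a = 1) \<and> q1 = 2 \<and> q2 = 1"
  by (auto simp: search_aut_def)

lemma search_aut_any: "t \<in> trees {0, 1} \<Longrightarrow> 0 \<in> ty (search_aut q0) t"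
  using run_const[of "search_aut q0" 0 t] by (auto simp: search_aut_def ty_def trees_def)

text \<open>State 1 is handed to exactly one child until it stops at a label 1, and its odd colour
  forces it to stop. The node where it stops determines the run, and there are only countably many
  nodes.\<close>

lemma search_aut_run:
  assumes \<phi>: "run (search_aut q0) 1 t \<phi>"
  shows "\<exists>v. t v = 1 \<and> \<phi> = (\<lambda>u. if prefix u v then 1 else 0)"
proof -
  have st: "(\<phi> v, t v, \<phi> (v @ [False]), \<phi> (v @ [True])) \<in> trans (search_aut q0)" for v
    using \<phi> by (simp add: run_def step_def)
  have zero: "\<phi> (v @ [b]) = 0" if "\<phi> v = 0" for v b
    using st[of v] that by (cases b) (simp_all add: search_aut_trans)
  have zero_append: "\<phi> (v @ w) = 0" if "\<phi> v = 0" for v w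
    using that zero[of "v @ _"] by (induction w rule: rev_induct) simp_all
  have one: "\<phi> v = 0 \<or> \<phi> v = 1" for v
  proof (induction v rule: rev_induct)
    case Nil
    then show ?case using \<phi> by (simp add: run_def)
  next
    case (snoc b v)
    then show ?case using st[of v] by (cases b) (auto simp: search_aut_trans)
  qed
  have "\<exists>v. \<phi> v = 1 \<and> \<phi> (v @ [False]) = 0 \<and> \<phi> (v @ [True]) = 0"
  proof (rule ccontr)
    assume "\<nexists>v. \<phi> v = 1 \<and> \<phi> (v @ [False]) = 0 \<and> \<phi> (v @ [True]) = 0"
    then have ex: "\<exists>b. \<phi> (v @ [b]) = 1" if "\<phi> v = 1" for v using one that by metis
    define p where "p n = ((\<lambda>v. v @ [SOME b. \<phi> (v @ [b]) = 1]) ^^ n) []" for n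
    have "\<phi> (p n) = 1" for n
    proof (induction n)
      case 0
      then show ?case using \<phi> by (simp add: p_def run_def)
    next
      case (Suc n)
      then show ?case using someI_ex[OF ex[OF Suc]] by (simp add: p_def)
    qed
    moreover have "is_branch p" by (auto simp: is_branch_def p_def)
    then obtain \<beta> where "p = pre \<beta>" by (auto simp: is_branch_iff)
    ultimately have "\<not> good_branch (search_aut q0) \<phi> \<beta>"
      unfolding good_branch_def by (intro not_parity_ok_const[of 1]) simp_all
    then show False using \<phi> by (simp add: run_def)
  qed
  then obtain v where v: "\<phi> v = 1" "\<phi> (v @ [False]) = 0" "\<phi> (v @ [True]) = 0" by blast
  have "t v = 1" using st[of v] v by (simp add: search_aut_trans)
  moreover have "\<phi> u = (if prefix u v then 1 else 0)" for u
  proof (induction u rule: rev_induct)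
    case Nil
    then show ?case using \<phi> by (simp add: run_def)
  next
    case (snoc b u)
    show ?case
    proof (cases "prefix u v")
      case False
      then have "\<phi> u = 0" "\<not> prefix (u @ [b]) v" using snoc by (auto dest: append_prefixD)
      then show ?thesis using zero by simp
    next
      case True
      then obtain w where w: "v = u @ w" by (auto simp: prefix_def)
      show ?thesis
      proof (cases w)
        case Nil
        then show ?thesis using w v by (cases b) (auto simp: prefix_def)
      next
        case (Cons c w')
        then have "\<phi> (u @ [c]) = 1" using zero_append[of "u @ [c]" w'] one[of "u @ [c]"] w v by auto
        moreover have "\<phi> u = 1" using snoc True by simp
        ultimately have "\<phi> (u @ [b]) = (if b = c then 1 else 0)"
          using st[of u] by (cases b; cases c) (auto simp: search_aut_trans)
        then show ?thesis using w Cons by simp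
      qed
    qed
  qed
  ultimately show ?thesis by blast
qed

lemma search_aut_marked:
  assumes "t \<in> trees {0, 1}"
  shows "1 \<in> ty (search_aut q0) t \<longleftrightarrow> t \<in> marked"
proof
  assume "1 \<in> ty (search_aut q0) t"
  then obtain \<phi> where "run (search_aut q0) 1 t \<phi>" by (auto simp: ty_def)
  then obtain v where "t v = 1" using search_aut_run by blast
  then show "t \<in> marked" using assms by (auto simp: marked_def)
next
  assume "t \<in> marked"
  then obtain v where "t v \<noteq> 0" by (auto simp: marked_def)
  moreover have "t v \<in> {0, 1}" using assms unfolding trees_def by blast
  ultimately have "t v = 1" by simp
  then show "1 \<in> ty (search_aut q0) t"
    using assms
  proof (induction v arbitrary: t)
    case Nil
    then show ?case
      using search_aut_any[OF sub_trees[OF Nil(2)]] by (subst ty_iff) (simp add: search_aut_trans)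
  next
    case (Cons b v)
    have sub: "sub t u \<in> trees {0, 1}" for u using Cons(3) by (rule sub_trees)
    then have any: "0 \<in> ty (search_aut q0) (sub t u)" for u by (rule search_aut_any)
    have "sub t [b] v = 1" using Cons(2) by (simp add: sub_apply)
    then have "Suc 0 \<in> ty (search_aut q0) (sub t [b])" using Cons(1) sub by simp
    moreover have "t [] = 0 \<or> t [] = 1" using Cons(3) by (auto simp: trees_def)
    ultimately show ?case
      using any by (subst ty_iff) (cases b; auto simp: search_aut_trans)
  qed
qed

lemma lang_search_aut: "lang (search_aut q0) = {t \<in> trees {0, 1}. q0 \<in> ty (search_aut q0) t}"
  by (simp add: lang_eq)

lemma lang_search_aut_1: "lang (search_aut 1) = marked"
  unfolding lang_search_aut using search_aut_marked[of _ 1] by (auto simp: marked_def)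

lemma search_aut_1_countably_ambiguous: "countably_ambiguous_lang {0, 1} marked"
proof -
  have "countable (ACC (search_aut 1) t)" for t
  proof (rule countable_subset)
    show "ACC (search_aut 1) t \<subseteq> range (\<lambda>v u. if prefix u v then 1 else 0)"
      using search_aut_run[of 1 t] by (auto simp: ACC_eq)
  qed simp
  then show ?thesis
    unfolding countably_ambiguous_lang_def
    using wf_search_aut[of 1] lang_search_aut_1
    by (intro exI[of _ "search_aut 1"]) simp
qed

text \<open>No initial state accepts the zero tree, so an initial state accepting the tree from
  \<open>ex_many_runs\<close> falls under the second alternative.\<close>

lemma marked_not_finitely_ambiguous: "\<not> finitely_ambiguous_lang {0, 1} marked"
proof
  assume "finitely_ambiguous_lang {0, 1} marked"
  then obtain A where A: "wf_pta A" "alph A = {0, 1}" "lang A = marked"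
    "\<And>t. t \<in> trees {0, 1} \<Longrightarrow> finite (ACC A t)"
    unfolding finitely_ambiguous_lang_def by blast
  obtain s where s: "s \<in> marked" and many: "\<And>q. q \<in> ty A s \<Longrightarrow> q \<notin> ty A zero_tree \<Longrightarrow>
      \<exists>u\<in>marked. infinite {\<phi>. run A q u \<phi>}"
    using ex_many_runs[OF A(1)] by metis
  then obtain q where q: "q \<in> init A" "q \<in> ty A s" unfolding A(3)[symmetric] lang_eq by blast
  have "zero_tree \<notin> lang A" unfolding A(3) by (simp add: marked_def)
  then have "q \<notin> ty A zero_tree"
    using q(1) zero_tree_trees[of "{0, 1}"] unfolding lang_eq A(2) by blast
  then obtain u where u: "u \<in> marked" "infinite {\<phi>. run A q u \<phi>}" using many q by blast
  moreover have "{\<phi>. run A q u \<phi>} \<subseteq> ACC A u" using q(1) by (auto simp: ACC_eq)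
  ultimately show False using A(4)[OF marked_trees] finite_subset by blast
qed

section \<open>A language that is not countably ambiguous\<close>

lemma lang_search_aut_2:
  "lang (search_aut 2) = {t \<in> trees {0, 1}. \<forall>i. sub t (hang i) \<in> marked}"
proof -
  let ?A = "search_aut 2"
  have "2 \<in> ty ?A t \<longleftrightarrow> (\<forall>i. sub t (hang i) \<in> marked)" if t: "t \<in> trees {0, 1}" for t
  proof
    assume "2 \<in> ty ?A t"
    show "\<forall>i. sub t (hang i) \<in> marked"
    proof
      fix i
      show "sub t (hang i) \<in> marked"
        using \<open>2 \<in> ty ?A t\<close> t
      proof (induction i arbitrary: t)
        case 0
        then have "1 \<in> ty ?A (sub t [True])" using ty_iff[of 2 ?A t] by (simp add: search_aut_trans)
        then show ?case using search_aut_marked[OF sub_trees[OF 0(2)]] by (simp add: hang_0)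
      next
        case (Suc i)
        then have "2 \<in> ty ?A (sub t [False])" using ty_iff[of 2 ?A t] by (simp add: search_aut_trans)
        then show ?case using Suc(1)[OF _ sub_trees[OF Suc(3)], of "[False]"] by (simp add: hang_Suc)
      qed
    qed
  next
    assume "\<forall>i. sub t (hang i) \<in> marked"
    then have "\<forall>h\<in>range hang. \<exists>\<phi>. run ?A 1 (sub t h) \<phi>"
      using search_aut_marked[OF sub_trees[OF t], of 2] by (simp add: ty_def)
    then obtain \<psi> where \<psi>: "\<And>h. h \<in> range hang \<Longrightarrow> run ?A 1 (sub t h) (\<psi> h)" by metis
    have "run ?A 2 t (graft (range hang) (\<lambda>v. if v \<in> range hang then 1 else 2) \<psi>)"
    proof (rule run_graft[OF antichain_hang])
      show "(if [] \<in> range hang then 1 else 2) = 2" by (auto simp: hang_def)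
    next
      fix v assume v: "\<not> below (range hang) v"
      then have "True \<notin> set v" by (simp add: below_hang)
      then have "v = replicate (length v) False" by (metis (full_types) replicate_eqI)
      then have "v @ [True] \<in> range hang" unfolding hang_def by (metis rangeI)
      moreover have "v \<notin> range hang" "v @ [False] \<notin> range hang"
        using \<open>True \<notin> set v\<close> by (auto simp: hang_def)
      moreover have "t v = 0 \<or> t v = 1" using t by (auto simp: trees_def)
      ultimately show "step ?A t (\<lambda>v. if v \<in> range hang then 1 else 2) v"
        by (simp add: step_def search_aut_trans)
    next
      \<comment> \<open>Such a branch stays in state 2, whose colour is even.\<close>
      fix \<beta> assume \<beta>: "\<And>n. \<not> below (range hang) (pre \<beta> n)"
      then have "pre \<beta> n \<notin> range hang" for n
        using belowI[of "pre \<beta> n" "range hang" "[]"] by auto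
      then show "good_branch ?A (\<lambda>v. if v \<in> range hang then 1 else 2) \<beta>"
        unfolding good_branch_def by (intro parity_ok_const[of 0]) simp_all
    qed (use \<psi> in simp)
    then show "2 \<in> ty ?A t" by (auto simp: ty_def)
  qed
  then show ?thesis unfolding lang_search_aut by auto
qed

lemma uncountable_sets_nat: "\<not> countable (UNIV :: nat set set)"
proof
  assume "countable (UNIV :: nat set set)"
  then have "range (from_nat_into (UNIV :: nat set set)) = UNIV"
    by (intro range_from_nat_into) auto
  then show False using Cantors_theorem[of "UNIV :: nat set"] by auto
qed

text \<open>Since every hanging subtree must be marked, the state reached there cannot accept the
  zero tree, and \<open>ex_many_runs\<close> provides a tree with two runs from it. Choosing between
  the two independently at infinitely many positions encodes every set of natural numbers in a run
  on one tree.\<close>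

lemma search_aut_2_not_countably_ambiguous:
  "\<not> countably_ambiguous_lang {0, 1} (lang (search_aut 2))"
proof
  assume "countably_ambiguous_lang {0, 1} (lang (search_aut 2))"
  then obtain A where A: "wf_pta A" "alph A = {0, 1}" "lang A = lang (search_aut 2)"
    "\<And>t. t \<in> trees {0, 1} \<Longrightarrow> countable (ACC A t)"
    by (auto simp: countably_ambiguous_lang_def)
  let ?H = "range hang"
  have H: "antichain ?H" by (rule antichain_hang)
  obtain s where s: "s \<in> marked" and many: "\<And>q. q \<in> ty A s \<Longrightarrow> q \<notin> ty A zero_tree \<Longrightarrow>
      \<exists>u\<in>marked. infinite {\<phi>. run A q u \<phi>}"
    using ex_many_runs[OF A(1)] by metis
  have zero: "zero_tree \<in> trees {0, 1}" by (rule zero_tree_trees) simp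
  define T where "T = graft ?H zero_tree (\<lambda>_. s)"
  have T: "T \<in> trees {0, 1}" unfolding T_def using zero marked_trees[OF s] by (intro graft_trees) auto
  have sub_T: "sub T h = s" if "h \<in> ?H" for h unfolding T_def using sub_graft[OF H that] .
  have "T \<in> lang A" unfolding A(3) lang_search_aut_2 using T sub_T s by simp
  then obtain q \<phi> where q: "q \<in> init A" and \<phi>: "run A q T \<phi>" unfolding lang_eq ty_def by blast
  have "\<exists>u \<rho>. u \<in> marked \<and> run A (\<phi> h) u (\<rho> True) \<and> run A (\<phi> h) u (\<rho> False) \<and> \<rho> True \<noteq> \<rho> False"
    if h: "h \<in> ?H" for h
  proof -
    have "\<phi> h \<notin> ty A zero_tree"
    proof
      assume "\<phi> h \<in> ty A zero_tree"
      then obtain \<psi> where "run A (\<phi> h) zero_tree \<psi>" by (auto simp: ty_def)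
      then have "q \<in> ty A (plug T h zero_tree)" using run_plug[OF \<phi>] by (auto simp: ty_def)
      moreover have "plug T h zero_tree \<in> trees {0, 1}" using T zero by (rule graft_trees)
      ultimately have "plug T h zero_tree \<in> lang A" using q by (auto simp: lang_eq A(2))
      then have "sub (plug T h zero_tree) h \<in> marked" using h unfolding A(3) lang_search_aut_2 by blast
      then show False by (simp add: marked_def)
    qed
    moreover have "\<phi> h \<in> ty A s" using ty_sub[OF \<phi>, of h] sub_T[OF h] by simp
    ultimately obtain u where u: "u \<in> marked" "infinite {\<psi>. run A (\<phi> h) u \<psi>}" using many by blast
    then obtain \<psi>1 where \<psi>1: "run A (\<phi> h) u \<psi>1" using not_finite_existsD by blast
    have "infinite ({\<psi>. run A (\<phi> h) u \<psi>} - {\<psi>1})" using u(2) by simp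
    then obtain \<psi>2 where "run A (\<phi> h) u \<psi>2" "\<psi>2 \<noteq> \<psi>1"
      by (metis (mono_tags, lifting) Diff_iff all_not_in_conv finite.emptyI insertI1 mem_Collect_eq)
    with u(1) \<psi>1 show ?thesis
      by (intro exI[of _ u] exI[of _ "\<lambda>b. if b then \<psi>1 else \<psi>2"]) simp
  qed
  then obtain u \<rho> where u: "\<And>h. h \<in> ?H \<Longrightarrow> u h \<in> marked"
    and \<rho>: "\<And>h b. h \<in> ?H \<Longrightarrow> run A (\<phi> h) (u h) (\<rho> h b)" "\<And>h. h \<in> ?H \<Longrightarrow> \<rho> h True \<noteq> \<rho> h False"
    by (metis (full_types))
  define U where "U = graft ?H zero_tree (\<lambda>h. if h \<in> ?H then u h else zero_tree)"
  have U: "U \<in> trees {0, 1}" unfolding U_def using zero marked_trees[OF u] by (intro graft_trees) auto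
  define \<Psi> where "\<Psi> X = graft ?H \<phi> (\<lambda>h. \<rho> h (h \<in> hang ` X))" for X
  have "run A q U (\<Psi> X)" for X
    unfolding \<Psi>_def
    by (rule run_graft_run[OF H \<phi>])
      (use \<rho> in \<open>simp_all add: U_def T_def graft_off sub_graft[OF H]\<close>)
  then have "range \<Psi> \<subseteq> ACC A U" using q by (auto simp: ACC_eq)
  then have "countable (range \<Psi>)" using A(4)[OF U] countable_subset by blast
  moreover have "inj \<Psi>"
  proof (rule injI)
    fix X X' assume eq: "\<Psi> X = \<Psi> X'"
    have "i \<in> X \<longleftrightarrow> i \<in> X'" for i
    proof -
      have i: "hang i \<in> ?H" by blast
      have "\<rho> (hang i) (hang i \<in> hang ` X) = \<rho> (hang i) (hang i \<in> hang ` X')"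
        using sub_graft[OF H i, of \<phi>] eq unfolding \<Psi>_def by metis
      then have "hang i \<in> hang ` X \<longleftrightarrow> hang i \<in> hang ` X'" using \<rho>(2)[OF i] by (metis (full_types))
      then show ?thesis by (simp add: inj_image_mem_iff[OF inj_hang])
    qed
    then show "X = X'" by blast
  qed
  ultimately show False using countable_image_inj_on uncountable_sets_nat by blast
qed

lemma regular_lang_lang: "wf_pta A \<Longrightarrow> regular_lang (alph A) (lang A)"
  by (auto simp: regular_lang_def)

theorem theorem1p1:
  shows "(\<forall>k::nat. k > 1 \<longrightarrow> (\<exists>\<Sigma> L. finite \<Sigma> \<and> regular_lang \<Sigma> L \<and>
            k_ambiguous_lang k \<Sigma> L \<and> \<not> k_ambiguous_lang (k - 1) \<Sigma> L))
       \<and> (\<exists>\<Sigma> L. finite \<Sigma> \<and> regular_lang \<Sigma> L \<and>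
            finitely_ambiguous_lang \<Sigma> L \<and> \<not> boundedly_ambiguous_lang \<Sigma> L)
       \<and> (\<exists>\<Sigma> L. finite \<Sigma> \<and> regular_lang \<Sigma> L \<and>
            countably_ambiguous_lang \<Sigma> L \<and> \<not> finitely_ambiguous_lang \<Sigma> L)
       \<and> (\<exists>\<Sigma> L. finite \<Sigma> \<and> regular_lang \<Sigma> L \<and> \<not> countably_ambiguous_lang \<Sigma> L)"
proof (intro conjI allI impI)
  fix k :: nat assume k: "k > 1"
  have "regular_lang {0, 1} (lang (bounded_aut k))"
    using regular_lang_lang[OF wf_bounded_aut[of k]] k by simp
  then show "\<exists>\<Sigma> L. finite \<Sigma> \<and> regular_lang \<Sigma> L \<and>
      k_ambiguous_lang k \<Sigma> L \<and> \<not> k_ambiguous_lang (k - 1) \<Sigma> L"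
    using bounded_aut_ambiguous[of k] bounded_aut_not_less_ambiguous[OF k] k
    by (intro exI[of _ "{0, 1}"] exI[of _ "lang (bounded_aut k)"]) simp
next
  have "regular_lang {0, 1, 2} (lang finite_aut)"
    using regular_lang_lang[OF wf_finite_aut] by simp
  then show "\<exists>\<Sigma> L. finite \<Sigma> \<and> regular_lang \<Sigma> L \<and>
      finitely_ambiguous_lang \<Sigma> L \<and> \<not> boundedly_ambiguous_lang \<Sigma> L"
    using finite_aut_finitely_ambiguous finite_aut_not_boundedly_ambiguous
    by (intro exI[of _ "{0, 1, 2}"] exI[of _ "lang finite_aut"]) simp
next
  have "regular_lang {0, 1} (lang (search_aut 1))"
    using regular_lang_lang[OF wf_search_aut[of 1]] by simp
  then have "regular_lang {0, 1} marked" unfolding lang_search_aut_1 .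
  then show "\<exists>\<Sigma> L. finite \<Sigma> \<and> regular_lang \<Sigma> L \<and>
      countably_ambiguous_lang \<Sigma> L \<and> \<not> finitely_ambiguous_lang \<Sigma> L"
    using search_aut_1_countably_ambiguous marked_not_finitely_ambiguous
    by (intro exI[of _ "{0, 1}"] exI[of _ marked]) simp
next
  have "regular_lang {0, 1} (lang (search_aut 2))"
    using regular_lang_lang[OF wf_search_aut[of 2]] by simp
  then show "\<exists>\<Sigma> L. finite \<Sigma> \<and> regular_lang \<Sigma> L \<and> \<not> countably_ambiguous_lang \<Sigma> L"
    using search_aut_2_not_countably_ambiguous
    by (intro exI[of _ "{0, 1}"] exI[of _ "lang (search_aut 2)"]) simp
qed

end
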